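(* Let $F$ be a field of characteristic not $2$, fix an algebraic closure $\overline F$ and $i\in\overline F$ with $i^2=-1$, and let $L\subseteq\overline F$ with $L/F$ an elementary abelian (quartic) extension. Then: \begin{enumerate} \item $L/F$ has the trivial radical closure $F$ if and only if $F(i)$ is a quadratic sub-extension of $L/F$. In this case $L/F$ is radical, and every radical generator of $L/F$ is of the form $\gamma(i+1)$, where $\gamma\in L$ is a radical generator of a quadratic sub-extension $F(\gamma)$ of $L/F$ with $F(\gamma)\neq F(i)$. \item $L/F$ has no radical closure if and only if $i\in F$. \item $L/F$ has exactly $3$ radical closures if and only if $i\notin L$. In this case the $3$ radical closures are precisely the fields $F(\gamma i)$, where $\gamma$ is a radical generator of a quadratic sub-extension of $L/F$. \end{enumerate}
   Context: $F$ is a field of characteristic different from $2$, and all extensions are taken inside $\overline F$ (composita are formed there). A quartic extension $L/F$ is elementary abelian if it is Galois with Galois group $\mathbb{Z}/2\mathbb{Z}\times\mathbb{Z}/2\mathbb{Z}$. A finite extension $M/K$ of degree $n$ is radical if it has a primitive element $\theta$ (a radical generator) with $\theta^n\in K$. A radical closure of a degree-$n$ extension $L/F$ is an extension $K/F$ of smallest degree such that the compositum $LK/K$ is a radical extension of degree $n$. *)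

theory Defs
  imports
    "HOL-Algebra.Algebraic_Closure"
    "HOL-Algebra.Generated_Fields"
    "HOL-Algebra.Bij"
    "HOL-Algebra.Elementary_Groups"
    "HOL-Library.Extended_Nat"
begin

text \<open>
  All fields are subfields of one ambient field \<open>R\<close> (an algebraic closure of the base field),
  represented by their carrier sets.
\<close>

definition ring_char :: "('a, 'b) ring_scheme \<Rightarrow> nat" where
  "ring_char R =
     (if \<exists>n::nat. n > 0 \<and> [n] \<cdot>\<^bsub>R\<^esub> \<one>\<^bsub>R\<^esub> = \<zero>\<^bsub>R\<^esub>
      then (LEAST n::nat. n > 0 \<and> [n] \<cdot>\<^bsub>R\<^esub> \<one>\<^bsub>R\<^esub> = \<zero>\<^bsub>R\<^esub>)
      else 0)"

definition field_extension :: "('a, 'b) ring_scheme \<Rightarrow> 'a set \<Rightarrow> 'a set \<Rightarrow> bool" where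
  "field_extension R K M \<longleftrightarrow> subfield K R \<and> subfield M R \<and> K \<subseteq> M"

definition ext_degree :: "('a, 'b) ring_scheme \<Rightarrow> 'a set \<Rightarrow> 'a set \<Rightarrow> enat" where
  "ext_degree R K M =
     (if ring.finite_dimension R K M then enat (ring.dim R K M) else \<infinity>)"

definition adjoin :: "('a, 'b) ring_scheme \<Rightarrow> 'a set \<Rightarrow> 'a \<Rightarrow> 'a set" where
  "adjoin R K x = generate_field R (insert x K)"

definition compositum :: "('a, 'b) ring_scheme \<Rightarrow> 'a set \<Rightarrow> 'a set \<Rightarrow> 'a set" where
  "compositum R L K = generate_field R (L \<union> K)"

text \<open>Automorphisms are extensional (undefined outside \<open>L\<close>), so that each is counted once.\<close>

definition galois_group :: "('a, 'b) ring_scheme \<Rightarrow> 'a set \<Rightarrow> 'a set \<Rightarrow> ('a \<Rightarrow> 'a) monoid" where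
  "galois_group R F L =
     BijGroup L \<lparr> carrier :=
       {\<sigma> \<in> Bij L. \<sigma> \<in> ring_iso (R\<lparr>carrier := L\<rparr>) (R\<lparr>carrier := L\<rparr>) \<and> (\<forall>x\<in>F. \<sigma> x = x)} \<rparr>"

definition galois_extension :: "('a, 'b) ring_scheme \<Rightarrow> 'a set \<Rightarrow> 'a set \<Rightarrow> bool" where
  "galois_extension R F L \<longleftrightarrow>
     field_extension R F L \<and>
     (\<forall>x\<in>L. (ring.algebraic R over F) x) \<and>
     {x \<in> L. \<forall>\<sigma>\<in>carrier (galois_group R F L). \<sigma> x = x} = F"

definition elementary_abelian_quartic :: "('a, 'b) ring_scheme \<Rightarrow> 'a set \<Rightarrow> 'a set \<Rightarrow> bool" where
  "elementary_abelian_quartic R F L \<longleftrightarrow>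
     ring.dimension R 4 F L \<and> galois_extension R F L \<and>
     galois_group R F L \<cong> integer_mod_group 2 \<times>\<times> integer_mod_group 2"

definition quadratic_subextension ::
  "('a, 'b) ring_scheme \<Rightarrow> 'a set \<Rightarrow> 'a set \<Rightarrow> 'a set \<Rightarrow> bool" where
  "quadratic_subextension R F L Q \<longleftrightarrow>
     field_extension R F Q \<and> field_extension R Q L \<and> ring.dimension R 2 F Q"

definition radical_generator ::
  "('a, 'b) ring_scheme \<Rightarrow> 'a set \<Rightarrow> 'a set \<Rightarrow> 'a \<Rightarrow> bool" where
  "radical_generator R K M \<theta> \<longleftrightarrow>
     \<theta> \<in> M \<and> adjoin R K \<theta> = M \<and>
     (\<exists>n::nat. ring.dimension R n K M \<and> \<theta> [^]\<^bsub>R\<^esub> n \<in> K)"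

definition radical_extension :: "('a, 'b) ring_scheme \<Rightarrow> 'a set \<Rightarrow> 'a set \<Rightarrow> bool" where
  "radical_extension R K M \<longleftrightarrow>
     field_extension R K M \<and> (\<exists>\<theta>. radical_generator R K M \<theta>)"

definition becomes_radical_over ::
  "('a, 'b) ring_scheme \<Rightarrow> 'a set \<Rightarrow> 'a set \<Rightarrow> 'a set \<Rightarrow> bool" where
  "becomes_radical_over R F L K \<longleftrightarrow>
     field_extension R F K \<and>
     radical_extension R K (compositum R L K) \<and>
     (\<exists>n. ring.dimension R n F L \<and> ring.dimension R n K (compositum R L K))"

definition radical_closure ::
  "('a, 'b) ring_scheme \<Rightarrow> 'a set \<Rightarrow> 'a set \<Rightarrow> 'a set \<Rightarrow> bool" where
  "radical_closure R F L K \<longleftrightarrow>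
     becomes_radical_over R F L K \<and>
     (\<forall>K'. becomes_radical_over R F L K' \<longrightarrow> ext_degree R F K \<le> ext_degree R F K')"

end

theory Submission
  imports Defs
begin

text \<open>
  Common eigenvectors of the Galois group yield \<open>a, b \<in> L\<close> with \<open>a\<^sup>2, b\<^sup>2 \<in> F\<close> and \<open>L = F(a, b)\<close>,
  and then everything rests on one remark: if \<open>d\<^sup>2 \<in> K\<close>, an element of \<open>K(d)\<close> outside \<open>K\<close> whose square lies in
  \<open>K\<close> is a \<open>K\<close>-multiple of \<open>d\<close>. It shows that a biquadratic extension \<open>M/K\<close> is radical iff
  \<open>i \<in> M - K\<close>. Hence, if \<open>i \<notin> L\<close> and \<open>LK/K\<close> is radical of degree 4, then \<open>i \<in> K(a, b) - K\<close> is a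
  \<open>K\<close>-multiple \<open>y c\<close> of some \<open>c \<in> {a, b, a b}\<close>, so \<open>K\<close> contains \<open>c i = y c\<^sup>2\<close>; the minimal such \<open>K\<close>
  are the three quadratic fields \<open>F(c i)\<close>.
\<close>

text \<open>The element i + 1 enters because (i + 1)^2 = 2 i. If \<gamma>^2 lies in K, then \<theta>
  = \<gamma> (i + 1) has \<theta>^2 = 2 \<gamma>^2 i and \<theta>^4 in K, so multiplication by i + 1
  turns a square root over K into a fourth root. For this, i must be available in M but not yet in
  K: otherwise \<theta>^2 already lies in K and \<theta> has degree at most 2. That is why i in F
  rules out every K at once. The obstacle to minimality is that the competing K are arbitrary
  extensions of F, possibly infinite and unrelated to L. They need not be classified: each one
  contains one of three fields of the same degree 2, which gives both the lower bound and the list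
  of minimal K. Characteristic different from 2 is what makes the cross term 2 x y of a square
  vanish only with x or y, and what separates the eigenvalues 1 and -1 of an involution.\<close>

context field
begin

subsection \<open>Adjoining square roots\<close>

lemma subfield_inv_mem:
  assumes "subfield K R" "k \<in> K" "k \<noteq> \<zero>"
  shows "inv k \<in> K"
  using subfield_m_inv(1)[OF assms(1)] assms(2,3) by blast

lemma inv_closed_right_inverse:
  assumes "x \<in> carrier R" "x \<noteq> \<zero>"
  shows "inv x \<in> carrier R" "x \<otimes> inv x = \<one>"
  using assms by (auto simp: field_Units)

lemma nat_pow_two: "x \<in> carrier R \<Longrightarrow> x [^] (2::nat) = x \<otimes> x"
  by (simp add: numeral_2_eq_2)

lemma nat_pow_four: "x \<in> carrier R \<Longrightarrow> x [^] (4::nat) = (x \<otimes> x) \<otimes> (x \<otimes> x)"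
  using nat_pow_mult[of x 2 2] by (simp add: nat_pow_two)

text \<open>Linear independence of 1 and d over K, in the form used to compare coefficients: a
  nonzero q could be divided out, which would put d into K.\<close>

lemma coefficient_zero:
  assumes K: "subfield K R" and "d \<in> carrier R" "d \<notin> K" and mem: "p \<in> K" "q \<in> K"
    and "p \<oplus> q \<otimes> d \<in> K"
  shows "q = \<zero>"
proof (rule ccontr)
  assume "q \<noteq> \<zero>"
  note sub = subringE[OF subfieldE(1)[OF K]]
  have car: "p \<in> carrier R" "q \<in> carrier R" using sub(1) mem by auto
  have "q \<otimes> d = (p \<oplus> q \<otimes> d) \<oplus> \<ominus> p"
    using car assms(2) by algebra
  then have "q \<otimes> d \<in> K" using sub(7)[OF assms(6) sub(5)[OF mem(1)]] by metis
  then show False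
    using subfield_m_inv_simprule[OF K _ assms(2), of q] mem \<open>q \<noteq> \<zero>\<close> assms(3) by blast
qed

lemma subfield_quadratic:
  assumes K: "subfield K R" and d: "d \<in> carrier R" "d \<otimes> d \<in> K"
  shows "subfield {z. \<exists>x\<in>K. \<exists>y\<in>K. z = x \<oplus> y \<otimes> d} R" (is "subfield ?Q R")
proof (rule subfieldI')
  note sub = subringE[OF subfieldE(1)[OF K]]
  have car: "\<And>x. x \<in> K \<Longrightarrow> x \<in> carrier R" using sub(1) by auto
  show "subring ?Q R"
  proof (rule subringI)
    show "?Q \<subseteq> carrier R" using car d by auto
    show "\<one> \<in> ?Q"
    proof -
      have "\<one> = \<one> \<oplus> \<zero> \<otimes> d" using d by simp
      then show ?thesis using sub(2,3) by blast
    qed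
    show "\<ominus> z \<in> ?Q" if hz: "z \<in> ?Q" for z
    proof -
      obtain x y where z: "x \<in> K" "y \<in> K" "z = x \<oplus> y \<otimes> d" using hz by blast
      have "\<ominus> z = \<ominus> x \<oplus> \<ominus> y \<otimes> d"
        unfolding z(3) using car[OF z(1)] car[OF z(2)] d(1) by algebra
      then show ?thesis using sub(5) z(1,2) by blast
    qed
    show "z \<otimes> w \<in> ?Q" if hz: "z \<in> ?Q" "w \<in> ?Q" for z w
    proof -
      obtain x y where z: "x \<in> K" "y \<in> K" "z = x \<oplus> y \<otimes> d" using hz by blast
      obtain u v where w: "u \<in> K" "v \<in> K" "w = u \<oplus> v \<otimes> d" using hz by blast
      have "z \<otimes> w = (x \<otimes> u \<oplus> y \<otimes> v \<otimes> (d \<otimes> d)) \<oplus> (x \<otimes> v \<oplus> y \<otimes> u) \<otimes> d"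
        unfolding z(3) w(3) using car[OF z(1)] car[OF z(2)] car[OF w(1)] car[OF w(2)] d(1)
        by algebra
      moreover have "x \<otimes> u \<oplus> y \<otimes> v \<otimes> (d \<otimes> d) \<in> K" "x \<otimes> v \<oplus> y \<otimes> u \<in> K"
        using z w d(2) sub(6,7) by auto
      ultimately show ?thesis by blast
    qed
    show "z \<oplus> w \<in> ?Q" if hz: "z \<in> ?Q" "w \<in> ?Q" for z w
    proof -
      obtain x y where z: "x \<in> K" "y \<in> K" "z = x \<oplus> y \<otimes> d" using hz by blast
      obtain u v where w: "u \<in> K" "v \<in> K" "w = u \<oplus> v \<otimes> d" using hz by blast
      have "z \<oplus> w = (x \<oplus> u) \<oplus> (y \<oplus> v) \<otimes> d"
        unfolding z(3) w(3) using car[OF z(1)] car[OF z(2)] car[OF w(1)] car[OF w(2)] d(1)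
        by algebra
      then show ?thesis using sub(7) z(1,2) w(1,2) by blast
    qed
  qed
  show "inv z \<in> ?Q" if hz: "z \<in> ?Q - {\<zero>}" for z
  proof -
    obtain x y where z: "x \<in> K" "y \<in> K" "z = x \<oplus> y \<otimes> d" using hz by blast
    note xy = car[OF z(1)] car[OF z(2)]
    have zc: "z \<in> carrier R" "z \<noteq> \<zero>" using hz z xy d by auto
    show ?thesis
    proof (cases "d \<in> K")
      case True
      then have "inv z \<in> K" using z sub(6,7) zc(2) subfield_inv_mem[OF K] by simp
      moreover have "inv z = inv z \<oplus> \<zero> \<otimes> d" using inv_closed_right_inverse[OF zc] d by simp
      ultimately show ?thesis using sub(2) by blast
    next
      case False
      \<comment> \<open>The norm of z, the product of z with its conjugate x - y d; the inverse of z
        is the conjugate divided by n. The case d \<in> K is split off because there the conjugate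
        may vanish although z does not.\<close>
      define n where "n = x \<otimes> x \<oplus> \<ominus> (y \<otimes> y \<otimes> (d \<otimes> d))"
      have n: "n \<in> K" unfolding n_def using z d sub(5-7) by simp
      have conj: "x \<oplus> (\<ominus> y) \<otimes> d \<noteq> \<zero>"
      proof
        assume *: "x \<oplus> (\<ominus> y) \<otimes> d = \<zero>"
        then have "\<ominus> y = \<zero>"
          using coefficient_zero[OF K d(1) False z(1), of "\<ominus> y"] sub(2,5) z(2) by simp
        then have "y = \<zero>" using xy by (metis minus_minus minus_zero)
        with * have "x = \<zero>" using xy d by simp
        with \<open>y = \<zero>\<close> zc(2) z(3) d show False by simp
      qed
      have zn: "z \<otimes> (x \<oplus> (\<ominus> y) \<otimes> d) = n"
        unfolding z(3) n_def using xy d(1) by algebra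
      then have "n \<noteq> \<zero>" using integral zc conj xy d by (metis a_inv_closed add.m_closed m_closed)
      note ni = inv_closed_right_inverse[OF car[OF n] this]
      have "z \<otimes> ((x \<oplus> (\<ominus> y) \<otimes> d) \<otimes> inv n) = n \<otimes> inv n"
        using ni zc xy d(1) zn by (metis a_inv_closed add.m_closed m_assoc m_closed)
      then have "inv z = (x \<oplus> (\<ominus> y) \<otimes> d) \<otimes> inv n"
        using ni zc xy d inv_closed_right_inverse[OF zc]
        by (metis a_closed a_inv_closed comm_inv_char m_closed)
      also have "\<dots> = x \<otimes> inv n \<oplus> (\<ominus> y \<otimes> inv n) \<otimes> d"
        using ni xy d(1) by algebra
      finally show ?thesis
        using sub(5,6) z(1,2) subfield_inv_mem[OF K n \<open>n \<noteq> \<zero>\<close>] by blast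
    qed
  qed
qed

lemma subset_adjoin: "K \<subseteq> adjoin R K x"
  unfolding adjoin_def using generate_field.incl[of _ "insert x K"] by blast

lemma mem_adjoin: "x \<in> adjoin R K x"
  unfolding adjoin_def using generate_field.incl[of x "insert x K"] by blast

lemma subfield_adjoin:
  assumes "K \<subseteq> carrier R" "x \<in> carrier R"
  shows "subfield (adjoin R K x) R"
  unfolding adjoin_def using assms by (intro generate_field_is_subfield) auto

lemma adjoin_least:
  assumes "subfield E R" "K \<subseteq> E" "x \<in> E"
  shows "adjoin R K x \<subseteq> E"
  unfolding adjoin_def
  using assms(2,3) subfieldE(3)[OF assms(1)]
  by (intro generate_field_min_subfield1[OF _ assms(1)]) blast+

lemma adjoin_mem_eq: "subfield K R \<Longrightarrow> x \<in> K \<Longrightarrow> adjoin R K x = K"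
  using adjoin_least[of K K x] subset_adjoin by blast

lemma mem_adjoin_sqrt_iff:
  assumes K: "subfield K R" and d: "d \<in> carrier R" "d \<otimes> d \<in> K"
  shows "z \<in> adjoin R K d \<longleftrightarrow> (\<exists>x\<in>K. \<exists>y\<in>K. z = x \<oplus> y \<otimes> d)"
proof
  note sub = subringE[OF subfieldE(1)[OF K]]
  have "K \<subseteq> {z. \<exists>x\<in>K. \<exists>y\<in>K. z = x \<oplus> y \<otimes> d}"
  proof
    fix x assume "x \<in> K"
    then have "x = x \<oplus> \<zero> \<otimes> d" using sub(1) d by auto
    then show "x \<in> {z. \<exists>x\<in>K. \<exists>y\<in>K. z = x \<oplus> y \<otimes> d}" using \<open>x \<in> K\<close> sub(2) by blast
  qed
  moreover have "d = \<zero> \<oplus> \<one> \<otimes> d" using d by simp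
  ultimately have "adjoin R K d \<subseteq> {z. \<exists>x\<in>K. \<exists>y\<in>K. z = x \<oplus> y \<otimes> d}"
    using sub(2,3) by (intro adjoin_least[OF subfield_quadratic[OF assms]]) blast+
  then show "z \<in> adjoin R K d \<Longrightarrow> \<exists>x\<in>K. \<exists>y\<in>K. z = x \<oplus> y \<otimes> d" by blast
next
  note sub = subringE[OF subfieldE(1)[OF subfield_adjoin[OF subfieldE(3)[OF K] d(1)]]]
  show "\<exists>x\<in>K. \<exists>y\<in>K. z = x \<oplus> y \<otimes> d \<Longrightarrow> z \<in> adjoin R K d"
    using sub(6,7) subset_adjoin[of K d] mem_adjoin[of d K] by blast
qed

text \<open>The square of x + y d has the coefficient 2 x y at d, which must vanish. Since z lies
  outside K, y is not zero, hence x is.\<close>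

lemma sqrt_in_adjoin_sqrt:
  assumes two: "\<one> \<oplus> \<one> \<noteq> \<zero>" and K: "subfield K R"
    and d: "d \<in> carrier R" "d \<otimes> d \<in> K" "d \<notin> K"
    and z: "z \<in> adjoin R K d" "z \<otimes> z \<in> K" "z \<notin> K"
  obtains y where "y \<in> K" "y \<noteq> \<zero>" "z = y \<otimes> d"
proof -
  note sub = subringE[OF subfieldE(1)[OF K]]
  obtain x y where xy: "x \<in> K" "y \<in> K" "z = x \<oplus> y \<otimes> d"
    using z(1) mem_adjoin_sqrt_iff[OF K d(1,2)] by blast
  have car: "x \<in> carrier R" "y \<in> carrier R" using xy sub(1) by auto
  have y0: "y \<noteq> \<zero>" using xy z(3) car d(1) by auto
  have "z \<otimes> z = (x \<otimes> x \<oplus> y \<otimes> y \<otimes> (d \<otimes> d)) \<oplus> ((\<one> \<oplus> \<one>) \<otimes> (x \<otimes> y)) \<otimes> d"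
    unfolding xy(3) using car d(1) by algebra
  moreover have "x \<otimes> x \<oplus> y \<otimes> y \<otimes> (d \<otimes> d) \<in> K" "(\<one> \<oplus> \<one>) \<otimes> (x \<otimes> y) \<in> K"
    using xy d(2) sub(3,6,7) by auto
  ultimately have "(\<one> \<oplus> \<one>) \<otimes> (x \<otimes> y) = \<zero>"
    using coefficient_zero[OF K d(1,3)] z(2) by metis
  then have "x = \<zero>" using two y0 car by (metis integral m_closed add.m_closed one_closed)
  then have "z = y \<otimes> d" using xy(3) car d by simp
  with y0 xy(2) that show thesis by blast
qed

lemma adjoin_scale:
  assumes K: "subfield K R" and "c \<in> K" "c \<noteq> \<zero>" and d: "d \<in> carrier R"
  shows "adjoin R K (c \<otimes> d) = adjoin R K d"
proof
  have cc: "c \<in> carrier R" using subsetD[OF subfieldE(3)[OF K] assms(2)] .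
  note s1 = subfield_adjoin[OF subfieldE(3)[OF K] d]
  note s2 = subfield_adjoin[OF subfieldE(3)[OF K] m_closed[OF cc d]]
  show "adjoin R K (c \<otimes> d) \<subseteq> adjoin R K d"
    using adjoin_least[OF s1 subset_adjoin subringE(6)[OF subfieldE(1)[OF s1]
      subsetD[OF subset_adjoin assms(2)] mem_adjoin]] .
  have "d \<in> adjoin R K (c \<otimes> d)"
    using subfield_m_inv_simprule[OF s2 _ d, of c] subset_adjoin mem_adjoin assms(2,3) by blast
  then show "adjoin R K d \<subseteq> adjoin R K (c \<otimes> d)"
    using adjoin_least[OF s2 subset_adjoin] by blast
qed

lemma dimension_two_adjoin_sqrt:
  assumes K: "subfield K R" and d: "d \<in> carrier R" "d \<otimes> d \<in> K" "d \<notin> K"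
  shows "dimension 2 K (adjoin R K d)"
proof -
  have car: "\<And>x. x \<in> K \<Longrightarrow> x \<in> carrier R" using subfieldE(3)[OF K] by auto
  have "adjoin R K d = line_extension K d K"
    using mem_adjoin_sqrt_iff[OF K d(1,2)] a_comm car d(1)
    by (fastforce simp: line_extension_mem_iff)
  then show ?thesis
    using Suc_dim[OF d(1,3) dimension_one[OF K]] by (simp add: numeral_2_eq_2)
qed

section \<open>Nested dimensions and the adjunction of two elements\<close>

lemma dimension_mono:
  assumes K: "subfield K R" and "dimension n K E" "dimension m K V" "E \<subseteq> V"
  shows "n \<le> m"
proof -
  obtain Us where Us: "set Us \<subseteq> carrier R" "independent K Us" "length Us = n" "Span K Us = E"
    using exists_base[OF K assms(2)] by blast
  then have "set Us \<subseteq> V" using Span_base_incl[OF K Us(1)] assms(4) by blast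
  then show ?thesis using independent_length_le_dimension[OF K assms(3) Us(2)] Us(3) by simp
qed

lemma dimension_subset_eq:
  assumes K: "subfield K R" and "dimension n K E" "dimension m K V" "E \<subseteq> V" "m \<le> n"
  shows "E = V"
proof -
  obtain Us where Us: "set Us \<subseteq> carrier R" "independent K Us" "length Us = n" "Span K Us = E"
    using exists_base[OF K assms(2)] by blast
  then have "set Us \<subseteq> V" using Span_base_incl[OF K Us(1)] assms(4) by blast
  then show ?thesis
    using independent_length_eq_dimension[OF K assms(3) Us(2)] dimension_mono[OF assms(1-4)] Us(3,4)
      assms(5) by simp
qed

lemma subfield_adjoin2:
  assumes "K \<subseteq> carrier R" "a \<in> carrier R" "b \<in> carrier R"
  shows "subfield (adjoin R (adjoin R K a) b) R"
  using subfield_adjoin[OF subfieldE(3)[OF subfield_adjoin[OF assms(1,2)]] assms(3)] .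

lemma subset_adjoin2:
  "K \<subseteq> adjoin R (adjoin R K a) b" "a \<in> adjoin R (adjoin R K a) b" "b \<in> adjoin R (adjoin R K a) b"
  using subset_adjoin[of K a] mem_adjoin[of a K] subset_adjoin[of "adjoin R K a" b]
    mem_adjoin[of b "adjoin R K a"]
  by auto

lemma adjoin2_least:
  assumes "subfield E R" "K \<subseteq> E" "a \<in> E" "b \<in> E"
  shows "adjoin R (adjoin R K a) b \<subseteq> E"
  using assms by (intro adjoin_least) auto

text \<open>Every compositum LK is generated over K by the same a and b, so a change of base field
  keeps the biquadratic shape.\<close>

lemma compositum_adjoin:
  assumes "subfield F R" "subfield K R" "F \<subseteq> K" "a \<in> carrier R" "b \<in> carrier R"
  shows "compositum R (adjoin R (adjoin R F a) b) K = adjoin R (adjoin R K a) b" (is "?l = ?r")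
proof
  note r = subfield_adjoin2[OF subfieldE(3)[OF assms(2)] assms(4,5)]
  note L = subfield_adjoin2[OF subfieldE(3)[OF assms(1)] assms(4,5)]
  have c: "adjoin R (adjoin R F a) b \<union> K \<subseteq> carrier R"
    using subfieldE(3)[OF L] subfieldE(3)[OF assms(2)] by blast
  have "adjoin R (adjoin R F a) b \<subseteq> ?r"
    using assms(3) subset_adjoin2[where K=K and a=a and b=b] by (intro adjoin2_least r) auto
  then show "?l \<subseteq> ?r"
    unfolding compositum_def using subset_adjoin2(1)[where K=K and a=a and b=b]
    by (intro generate_field_min_subfield1[OF c r]) auto
  have l: "subfield ?l R" unfolding compositum_def by (rule generate_field_is_subfield[OF c])
  have "adjoin R (adjoin R F a) b \<union> K \<subseteq> ?l"
    unfolding compositum_def by (auto intro: generate_field.incl)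
  then show "?r \<subseteq> ?l"
    using subset_adjoin2[where K=F and a=a and b=b] by (intro adjoin2_least l) auto
qed

subsection \<open>Biquadratic extensions\<close>

text \<open>The degree is 1 or 2. This supplies the recurring contradiction that a quartic field
  would be generated by a single square root.\<close>

lemma not_dimension_four_adjoin_sqrt:
  assumes K: "subfield K R" and d: "d \<in> carrier R" "d \<otimes> d \<in> K"
  shows "\<not> dimension 4 K (adjoin R K d)"
proof (cases "d \<in> K")
  case True
  then show ?thesis
    using adjoin_mem_eq[OF K] dimension_one[OF K] dimension_is_inj[OF K, of 1 K 4] by auto
next
  case False
  then show ?thesis
    using dimension_two_adjoin_sqrt[OF K d] dimension_is_inj[OF K, of 2 _ 4] by fastforce
qed

lemma dimension_four_biquadratic_iff:
  assumes K: "subfield K R" and ab: "a \<in> carrier R" "b \<in> carrier R"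
    and sq: "a \<otimes> a \<in> K" "b \<otimes> b \<in> K"
  shows "dimension 4 K (adjoin R (adjoin R K a) b) \<longleftrightarrow> a \<notin> K \<and> b \<notin> adjoin R K a"
proof
  note Ka = subfield_adjoin[OF subfieldE(3)[OF K] ab(1)]
  have sqb: "b \<otimes> b \<in> adjoin R K a" using sq(2) subset_adjoin[of K a] by blast
  show "dimension 4 K (adjoin R (adjoin R K a) b) \<Longrightarrow> a \<notin> K \<and> b \<notin> adjoin R K a"
    using not_dimension_four_adjoin_sqrt[OF K ab(1) sq(1)]
      not_dimension_four_adjoin_sqrt[OF K ab(2) sq(2)]
      adjoin_mem_eq[OF K, of a] adjoin_mem_eq[OF Ka, of b] by auto
  assume "a \<notin> K \<and> b \<notin> adjoin R K a"
  then show "dimension 4 K (adjoin R (adjoin R K a) b)"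
    using telescopic_base[OF K Ka dimension_two_adjoin_sqrt[OF K ab(1) sq(1)]
      dimension_two_adjoin_sqrt[OF Ka ab(2) sqb]] by simp
qed

text \<open>Replaces a condition in the tower K(a) by conditions over K alone: together with a
  \<notin> K, independence of the two roots means that none of a, b and a b lies in K.\<close>

lemma sqrt_mem_adjoin_sqrt_iff:
  assumes two: "\<one> \<oplus> \<one> \<noteq> \<zero>" and K: "subfield K R" and ab: "a \<in> carrier R" "b \<in> carrier R"
    and sq: "a \<otimes> a \<in> K" "b \<otimes> b \<in> K" and "a \<notin> K"
  shows "b \<in> adjoin R K a \<longleftrightarrow> b \<in> K \<or> a \<otimes> b \<in> K"
proof
  note Ka = subfield_adjoin[OF subfieldE(3)[OF K] ab(1)]
  note sub = subringE[OF subfieldE(1)[OF K]]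
  have a0: "a \<noteq> \<zero>" using assms(7) sub(2) by auto
  show "b \<in> K \<or> a \<otimes> b \<in> K" if bKa: "b \<in> adjoin R K a"
  proof (rule disjCI)
    assume "a \<otimes> b \<notin> K"
    show "b \<in> K"
    proof (rule ccontr)
      assume "b \<notin> K"
      then obtain y where y: "y \<in> K" "b = y \<otimes> a"
        using sqrt_in_adjoin_sqrt[OF two K ab(1) sq(1) assms(7) bKa sq(2)] by metis
      have "a \<otimes> b = y \<otimes> (a \<otimes> a)"
        unfolding y(2) using sub(1) y(1) ab(1) by (simp add: m_lcomm subsetD)
      then show False using \<open>a \<otimes> b \<notin> K\<close> sub(6) y(1) sq(1) by metis
    qed
  qed
  show "b \<in> adjoin R K a" if "b \<in> K \<or> a \<otimes> b \<in> K"
    using that subset_adjoin[of K a] mem_adjoin[of a K]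
      subfield_m_inv_simprule[OF Ka _ ab(2), of a] a0 by blast
qed

text \<open>The one-step result is applied at each level of the tower. Over K(a) it gives z = y b;
  then y^2 = z^2 / b^2 lies in K, so y itself is in K or is a K-multiple of a.\<close>

lemma sqrt_in_biquadratic:
  assumes two: "\<one> \<oplus> \<one> \<noteq> \<zero>" and K: "subfield K R" and ab: "a \<in> carrier R" "b \<in> carrier R"
    and sq: "a \<otimes> a \<in> K" "b \<otimes> b \<in> K" and nin: "a \<notin> K" "b \<notin> adjoin R K a"
    and z: "z \<in> adjoin R (adjoin R K a) b" "z \<otimes> z \<in> K" "z \<notin> K"
  obtains c y where "c \<in> {a, b, a \<otimes> b}" "y \<in> K" "y \<noteq> \<zero>" "z = y \<otimes> c"
proof (cases "z \<in> adjoin R K a")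
  case True
  then show ?thesis using sqrt_in_adjoin_sqrt[OF two K ab(1) sq(1) nin(1) _ z(2,3)] that by blast
next
  case False
  note Ka = subfield_adjoin[OF subfieldE(3)[OF K] ab(1)]
  note subK = subset_adjoin[of K a]
  obtain y where y: "y \<in> adjoin R K a" "y \<noteq> \<zero>" "z = y \<otimes> b"
    using sqrt_in_adjoin_sqrt[OF two Ka ab(2) _ nin(2) z(1) _ False] sq(2) z(2) subK by blast
  have yc: "y \<in> carrier R" using y(1) subfieldE(3)[OF Ka] by blast
  have b0: "b \<noteq> \<zero>" using nin(2) subringE(2)[OF subfieldE(1)[OF Ka]] by auto
  have "z \<otimes> z = (b \<otimes> b) \<otimes> (y \<otimes> y)" unfolding y(3) using yc ab(2) by algebra
  then have yy: "y \<otimes> y \<in> K"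
    using subfield_m_inv_simprule[OF K, of "b \<otimes> b" "y \<otimes> y"] sq(2) z(2) yc ab b0 integral by auto
  show ?thesis
  proof (cases "y \<in> K")
    case True
    then show ?thesis using that y by blast
  next
    case False
    then obtain w where w: "w \<in> K" "w \<noteq> \<zero>" "y = w \<otimes> a"
      using sqrt_in_adjoin_sqrt[OF two K ab(1) sq(1) nin(1) y(1) yy] by blast
    then have "z = w \<otimes> (a \<otimes> b)" using y(3) ab subfieldE(3)[OF K] by (auto simp: m_assoc)
    then show ?thesis using that w by blast
  qed
qed

text \<open>
  If \<open>\<theta>\<close> generates the biquadratic field \<open>M\<close> and \<open>t = \<theta>\<^sup>2\<close>, then \<open>M\<close> contains some \<open>\<beta>\<close> outside
  \<open>K(t)\<close> with \<open>\<beta>\<^sup>2 \<in> K\<close>, and \<open>\<theta> = (u + v t) \<beta>\<close> with \<open>u, v \<in> K\<close>. Comparing coefficients in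
  \<open>t = (u + v t)\<^sup>2 \<beta>\<^sup>2\<close> gives \<open>(v t)\<^sup>2 = - u\<^sup>2\<close>.
\<close>

lemma radical_generator_biquadratic:
  assumes two: "\<one> \<oplus> \<one> \<noteq> \<zero>" and K: "subfield K R" and ab: "a \<in> carrier R" "b \<in> carrier R"
    and sq: "a \<otimes> a \<in> K" "b \<otimes> b \<in> K"
    and M: "M = adjoin R (adjoin R K a) b" "dimension 4 K M"
    and i: "i \<in> carrier R" "i \<otimes> i = \<ominus> \<one>"
    and gen: "radical_generator R K M \<theta>"
  shows "i \<in> M" "i \<notin> K"
    "\<exists>\<gamma>\<in>M. \<gamma> \<otimes> \<gamma> \<in> K \<and> \<gamma> \<notin> adjoin R K i \<and> \<theta> = \<gamma> \<otimes> (i \<oplus> \<one>)"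
proof -
  note sub = subringE[OF subfieldE(1)[OF K]]
  have Msf: "subfield M R" unfolding M(1) using subfield_adjoin2[OF sub(1) ab] .
  note subM = subringE[OF subfieldE(1)[OF Msf]]
  have KM: "K \<subseteq> M" "a \<in> M" "b \<in> M"
    unfolding M(1) using subset_adjoin2[where K=K and a=a and b=b] by auto
  obtain n :: nat where \<theta>: "\<theta> \<in> M" "adjoin R K \<theta> = M" "dimension n K M" "\<theta> [^] n \<in> K"
    using gen unfolding radical_generator_def by blast
  have \<theta>c: "\<theta> \<in> carrier R" using \<theta>(1) subM(1) by blast
  have "n = 4" using dimension_is_inj[OF K \<theta>(3) M(2)] .
  \<comment> \<open>A fourth root is reached by two quadratic steps: t is a square root over K, and
    \<theta> is a square root over K(t).\<close>
  define t where "t = \<theta> \<otimes> \<theta>"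
  have tt: "t \<otimes> t \<in> K" using \<theta>(4) \<open>n = 4\<close> \<theta>c unfolding t_def by (simp add: nat_pow_four)
  have tc: "t \<in> carrier R" unfolding t_def using \<theta>c by simp
  have tK: "t \<notin> K"
    using not_dimension_four_adjoin_sqrt[OF K \<theta>c] M(2) \<theta>(2) unfolding t_def by auto
  define Q where "Q = adjoin R K t"
  have Q: "subfield Q R" unfolding Q_def using subfield_adjoin[OF sub(1) tc] .
  note subQ = subringE[OF subfieldE(1)[OF Q]]
  have KQ: "K \<subseteq> Q" "t \<in> Q" unfolding Q_def using subset_adjoin mem_adjoin by auto
  have QM: "Q \<subseteq> M" unfolding Q_def
    using subM(6)[OF \<theta>(1) \<theta>(1)] KM(1) by (intro adjoin_least Msf) (auto simp: t_def)
  have dQ: "\<not> dimension 4 K Q"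
    unfolding Q_def using not_dimension_four_adjoin_sqrt[OF K tc tt] .
  have "\<theta> \<notin> Q"
    using adjoin_least[OF Q KQ(1), of \<theta>] \<theta>(2) QM dQ M(2) by auto
  have Q\<theta>: "adjoin R Q \<theta> = M"
  proof
    show "adjoin R Q \<theta> \<subseteq> M" using adjoin_least[OF Msf QM \<theta>(1)] .
    show "M \<subseteq> adjoin R Q \<theta>"
      using adjoin_least[OF subfield_adjoin[OF subQ(1) \<theta>c], of K \<theta>] KQ(1) subset_adjoin[of Q \<theta>]
        mem_adjoin[of \<theta> Q] \<theta>(2) by auto
  qed
  \<comment> \<open>If both roots were in Q, then M = Q, contrary to the degree. The one outside Q
    is a square root over Q as well as over K, so it can be compared with \<theta>.\<close>
  have "a \<notin> Q \<or> b \<notin> Q"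
    using adjoin2_least[OF Q KQ(1), of a b] M QM dQ by auto
  then obtain \<beta> where \<beta>: "\<beta> \<in> M" "\<beta> \<notin> Q" "\<beta> \<otimes> \<beta> \<in> K"
    using KM sq by blast
  have \<beta>c: "\<beta> \<in> carrier R" using \<beta>(1) subM(1) by blast
  obtain y where y: "y \<in> Q" "y \<noteq> \<zero>" "\<beta> = y \<otimes> \<theta>"
    using sqrt_in_adjoin_sqrt[OF two Q \<theta>c _ \<open>\<theta> \<notin> Q\<close>, of \<beta>] \<beta> KQ Q\<theta> t_def by auto
  have yc: "y \<in> carrier R" using y(1) subQ(1) by blast
  note yi = inv_closed_right_inverse[OF yc y(2)]
  have "inv y \<in> Q" using subfield_inv_mem[OF Q y(1,2)] .
  then obtain u v where uv: "u \<in> K" "v \<in> K" "inv y = u \<oplus> v \<otimes> t"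
    using mem_adjoin_sqrt_iff[OF K tc tt] unfolding Q_def by blast
  have uc: "u \<in> carrier R" "v \<in> carrier R" using uv sub(1) by auto
  have "inv y \<otimes> \<beta> = (y \<otimes> inv y) \<otimes> \<theta>"
    unfolding y(3) using yi(1) yc \<theta>c by algebra
  then have \<theta>eq: "\<theta> = (u \<oplus> v \<otimes> t) \<otimes> \<beta>" using yi(2) \<theta>c uv(3) by simp
  define B where "B = \<beta> \<otimes> \<beta>"
  have B: "B \<in> K" "B \<in> carrier R" unfolding B_def using \<beta>(3) \<beta>c by auto
  \<comment> \<open>\<open>p\<close> and \<open>q\<close> are the coefficients at 1 and t of (u + v
    t)^2 B - t; this is where the summand -1 in \<open>q\<close> comes from.\<close>
  define p where "p = (u \<otimes> u \<oplus> v \<otimes> v \<otimes> (t \<otimes> t)) \<otimes> B"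
  define q where "q = (\<one> \<oplus> \<one>) \<otimes> (u \<otimes> v) \<otimes> B \<oplus> \<ominus> \<one>"
  have pq: "p \<in> K" "q \<in> K" unfolding p_def q_def using uv tt B sub by auto
  define w where "w = u \<oplus> v \<otimes> t"
  have wc: "w \<in> carrier R" unfolding w_def using uc tc by simp
  have "t = (w \<otimes> \<beta>) \<otimes> (w \<otimes> \<beta>)" using \<theta>eq t_def unfolding w_def by metis
  also have "\<dots> = (w \<otimes> w) \<otimes> B" unfolding B_def using wc \<beta>c by algebra
  finally have "t = ((u \<oplus> v \<otimes> t) \<otimes> (u \<oplus> v \<otimes> t)) \<otimes> B" unfolding w_def .
  moreover have "((u \<oplus> v \<otimes> t) \<otimes> (u \<oplus> v \<otimes> t)) \<otimes> B = p \<oplus> q \<otimes> t \<oplus> t"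
    unfolding p_def q_def using uc tc B(2) by algebra
  ultimately have t_eq: "p \<oplus> q \<otimes> t \<oplus> t = t" by simp
  have "p \<in> carrier R" "q \<in> carrier R" using pq sub(1) by auto
  then have "p \<oplus> q \<otimes> t = (p \<oplus> q \<otimes> t \<oplus> t) \<oplus> \<ominus> t" using tc by algebra
  then have pqt: "p \<oplus> q \<otimes> t = \<zero>" unfolding t_eq using tc by (simp add: r_neg)
  then have q0: "q = \<zero>" using coefficient_zero[OF K tc tK pq] sub(2) by simp
  then have p0: "p = \<zero>" using pqt pq(1) sub(1) tc by auto
  \<comment> \<open>Vanishing of \<open>q\<close> reads 2 u v B = 1, so u, v and B are all nonzero,
    and B can be cancelled from \<open>p\<close> = 0.\<close>
  have one: "(\<one> \<oplus> \<one>) \<otimes> (u \<otimes> v) \<otimes> B = \<one>"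
    using minus_equality[OF q0[unfolded q_def]] uc B(2) by simp
  have u0: "u \<noteq> \<zero>" and v0: "v \<noteq> \<zero>" and B0: "B \<noteq> \<zero>"
    using one uc B(2) one_not_zero by auto
  have "u \<otimes> u \<oplus> v \<otimes> v \<otimes> (t \<otimes> t) = \<zero>"
    using p0 B0 B(2) uc tc integral unfolding p_def by (metis add.m_closed m_closed)
  \<comment> \<open>As i^2 = -1, the sum u^2 + (v t)^2 splits into two linear factors.\<close>
  moreover have "(v \<otimes> t \<oplus> \<ominus> (u \<otimes> i)) \<otimes> (v \<otimes> t \<oplus> u \<otimes> i) = v \<otimes> v \<otimes> (t \<otimes> t) \<oplus> \<ominus> (u \<otimes> u \<otimes> (i \<otimes> i))"
    using uc tc i(1) by algebra
  moreover have "v \<otimes> v \<otimes> (t \<otimes> t) \<oplus> \<ominus> (u \<otimes> u \<otimes> (i \<otimes> i)) = u \<otimes> u \<oplus> v \<otimes> v \<otimes> (t \<otimes> t)"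
    unfolding i(2) using uc tc by algebra
  ultimately have "(v \<otimes> t \<oplus> \<ominus> (u \<otimes> i)) \<otimes> (v \<otimes> t \<oplus> u \<otimes> i) = \<zero>" by simp
  then have "v \<otimes> t \<oplus> \<ominus> (u \<otimes> i) = \<zero> \<or> v \<otimes> t \<oplus> u \<otimes> i = \<zero>"
    using uc tc i(1) by (intro integral) auto
  then have cases: "v \<otimes> t = u \<otimes> i \<or> v \<otimes> t = \<ominus> (u \<otimes> i)"
    using uc tc i(1) minus_equality[of "v \<otimes> t" "u \<otimes> i"] minus_equality[of "v \<otimes> t" "\<ominus> (u \<otimes> i)"]
    by auto
  then have ui: "u \<otimes> i = v \<otimes> t \<or> u \<otimes> i = \<ominus> (v \<otimes> t)"
    using uc tc i(1) by auto
  have vtQ: "v \<otimes> t \<in> Q" using subQ(6) uv(2) KQ by blast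
  then have "u \<otimes> i \<in> Q" using ui subQ(5) by auto
  then have iQ: "i \<in> Q" using subfield_m_inv_simprule[OF Q _ i(1), of u] uv(1) KQ u0 by blast
  then show iM: "i \<in> M" using QM by blast
  show iK: "i \<notin> K"
  proof
    assume "i \<in> K"
    then have "v \<otimes> t \<in> K" using cases sub(5,6) uv(1) by auto
    then show False using subfield_m_inv_simprule[OF K _ tc, of v] uv(2) v0 tK by blast
  qed
  have "\<exists>\<gamma>\<in>M. \<gamma> \<otimes> \<gamma> \<in> K \<and> \<theta> = \<gamma> \<otimes> (i \<oplus> \<one>)"
    using cases
  proof
    assume *: "v \<otimes> t = u \<otimes> i"
    have "(u \<otimes> \<beta>) \<otimes> (u \<otimes> \<beta>) = u \<otimes> u \<otimes> B" unfolding B_def using uc \<beta>c by algebra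
    moreover have "\<theta> = (u \<otimes> \<beta>) \<otimes> (i \<oplus> \<one>)"
      unfolding \<theta>eq * using uc \<beta>c i(1) by algebra
    moreover have "u \<otimes> \<beta> \<in> M" using subM(6) KM(1) uv(1) \<beta>(1) by blast
    ultimately show ?thesis using uv(1) B(1) sub(6) by metis
  next
    assume *: "v \<otimes> t = \<ominus> (u \<otimes> i)"
    \<comment> \<open>Here \<theta> = u (1 - i) \<beta>. Since 1 - i = - i (i + 1), the factor - i
      is moved into \<gamma>, where it only changes the sign of the square.\<close>
    define \<gamma> where "\<gamma> = \<ominus> (i \<otimes> (u \<otimes> \<beta>))"
    have "\<gamma> \<otimes> \<gamma> = (i \<otimes> i) \<otimes> (u \<otimes> u \<otimes> B)" unfolding B_def \<gamma>_def using uc \<beta>c i(1) by algebra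
    then have "\<gamma> \<otimes> \<gamma> \<in> K" unfolding i(2) using uv(1) B(1) sub(3,5,6) by auto
    moreover have "\<theta> = \<gamma> \<otimes> (i \<oplus> \<one>)"
    proof -
      have "\<gamma> \<otimes> (i \<oplus> \<one>) = \<ominus> ((i \<otimes> i) \<otimes> (u \<otimes> \<beta>)) \<oplus> \<ominus> (u \<otimes> i) \<otimes> \<beta>"
        unfolding \<gamma>_def using uc \<beta>c i(1) by algebra
      also have "\<dots> = (u \<oplus> \<ominus> (u \<otimes> i)) \<otimes> \<beta>"
        unfolding i(2) using uc \<beta>c i(1) by algebra
      finally show ?thesis unfolding \<theta>eq * by simp
    qed
    moreover have "\<gamma> \<in> M"
      unfolding \<gamma>_def using subM(5)[OF subM(6)[OF iM subM(6)[OF _ \<beta>(1)]]] KM(1) uv(1) by auto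
    ultimately show ?thesis by blast
  qed
  then obtain \<gamma> where \<gamma>: "\<gamma> \<in> M" "\<gamma> \<otimes> \<gamma> \<in> K" "\<theta> = \<gamma> \<otimes> (i \<oplus> \<one>)" by blast
  have iiK: "i \<otimes> i \<in> K" unfolding i(2) using sub(3,5) by simp
  \<comment> \<open>Otherwise \<theta>, and with it all of M, would lie in K(i), which has degree at
    most 2.\<close>
  have "\<gamma> \<notin> adjoin R K i"
  proof
    note Ki = subfield_adjoin[OF sub(1) i(1)]
    note subKi = subringE[OF subfieldE(1)[OF Ki]]
    assume "\<gamma> \<in> adjoin R K i"
    then have "\<theta> \<in> adjoin R K i"
      unfolding \<gamma>(3) using subKi(6)[OF _ subKi(7)[OF mem_adjoin subKi(3)]] by simp
    then have "M \<subseteq> adjoin R K i"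
      using adjoin_least[OF Ki subset_adjoin] \<theta>(2) by blast
    moreover have "adjoin R K i \<subseteq> M" using adjoin_least[OF Msf KM(1) iM] .
    ultimately show False
      using not_dimension_four_adjoin_sqrt[OF K i(1) iiK] M(2) by auto
  qed
  with \<gamma> show "\<exists>\<gamma>\<in>M. \<gamma> \<otimes> \<gamma> \<in> K \<and> \<gamma> \<notin> adjoin R K i \<and> \<theta> = \<gamma> \<otimes> (i \<oplus> \<one>)" by blast
qed

text \<open>As M is larger than K(i), one of a and b, called \<gamma>, lies outside K(i), and M =
  K(i, \<gamma>). The square of \<gamma> (i + 1) is 2 \<gamma>^2 i: dividing by 2 \<gamma>^2
  recovers i, and then dividing the generator by i + 1 recovers \<gamma>.\<close>

lemma radical_biquadratic:
  assumes two: "\<one> \<oplus> \<one> \<noteq> \<zero>" and K: "subfield K R" and ab: "a \<in> carrier R" "b \<in> carrier R"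
    and sq: "a \<otimes> a \<in> K" "b \<otimes> b \<in> K"
    and M: "M = adjoin R (adjoin R K a) b" "dimension 4 K M"
    and i: "i \<in> M" "i \<notin> K" "i \<otimes> i = \<ominus> \<one>"
  shows "radical_extension R K M"
proof -
  note sub = subringE[OF subfieldE(1)[OF K]]
  have Msf: "subfield M R" unfolding M(1) using subfield_adjoin2[OF sub(1) ab] .
  note subM = subringE[OF subfieldE(1)[OF Msf]]
  have KM: "K \<subseteq> M" "a \<in> M" "b \<in> M"
    unfolding M(1) using subset_adjoin2[where K=K and a=a and b=b] by auto
  have ic: "i \<in> carrier R" using i(1) subM(1) by blast
  have iiK: "i \<otimes> i \<in> K" unfolding i(3) using sub(3,5) by simp
  note Ki = subfield_adjoin[OF sub(1) ic]
  have "\<not> M \<subseteq> adjoin R K i"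
    using not_dimension_four_adjoin_sqrt[OF K ic iiK] M(2) adjoin_least[OF Msf KM(1) i(1)] by auto
  then have "a \<notin> adjoin R K i \<or> b \<notin> adjoin R K i"
    using adjoin2_least[OF Ki subset_adjoin] M(1) by blast
  then obtain \<gamma> where \<gamma>: "\<gamma> \<in> M" "\<gamma> \<otimes> \<gamma> \<in> K" "\<gamma> \<notin> adjoin R K i" using KM sq by blast
  have \<gamma>c: "\<gamma> \<in> carrier R" using \<gamma>(1) subM(1) by blast
  have "\<gamma> \<notin> K" using \<gamma>(3) subset_adjoin[of K i] by blast
  then have \<gamma>0: "\<gamma> \<noteq> \<zero>" using sub(2) by auto
  have d4: "dimension 4 K (adjoin R (adjoin R K i) \<gamma>)"
    using dimension_four_biquadratic_iff[OF K ic \<gamma>c iiK \<gamma>(2)] i(2) \<gamma>(3) by simp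
  have ME: "adjoin R (adjoin R K i) \<gamma> = M"
    using dimension_subset_eq[OF K d4 M(2)] adjoin2_least[OF Msf KM(1) i(1) \<gamma>(1)] by simp
  define \<theta> where "\<theta> = \<gamma> \<otimes> (i \<oplus> \<one>)"
  have \<theta>M: "\<theta> \<in> M" unfolding \<theta>_def using subM(6)[OF \<gamma>(1) subM(7)[OF i(1) subM(3)]] .
  then have \<theta>c: "\<theta> \<in> carrier R" using subM(1) by blast
  define c where "c = (\<one> \<oplus> \<one>) \<otimes> (\<gamma> \<otimes> \<gamma>)"
  have cK: "c \<in> K" unfolding c_def using sub(3,6,7) \<gamma>(2) by simp
  then have cc: "c \<in> carrier R" using sub(1) by blast
  have c0: "c \<noteq> \<zero>" unfolding c_def using two \<gamma>0 \<gamma>c integral by auto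
  have "\<theta> \<otimes> \<theta> = \<gamma> \<otimes> \<gamma> \<otimes> (i \<otimes> i) \<oplus> c \<otimes> i \<oplus> \<gamma> \<otimes> \<gamma>"
    unfolding \<theta>_def c_def using \<gamma>c ic by algebra
  also have "\<dots> = c \<otimes> i" unfolding i(3) using cc \<gamma>c ic by algebra
  finally have \<theta>2: "\<theta> \<otimes> \<theta> = c \<otimes> i" .
  note N = subfield_adjoin[OF sub(1) \<theta>c]
  note subN = subringE[OF subfieldE(1)[OF N]]
  have KN: "K \<subseteq> adjoin R K \<theta>" "\<theta> \<in> adjoin R K \<theta>" using subset_adjoin mem_adjoin by auto
  have iN: "i \<in> adjoin R K \<theta>"
    using subfield_m_inv_simprule[OF N _ ic, of c] \<theta>2 subN(6)[OF KN(2,2)] KN(1) cK c0 by auto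
  have "i \<oplus> \<one> \<noteq> \<zero>"
    using i(2) sub(3,5) ic by (metis minus_equality one_closed)
  moreover have "(i \<oplus> \<one>) \<otimes> \<gamma> \<in> adjoin R K \<theta>"
    using KN(2) \<gamma>c ic unfolding \<theta>_def by (simp add: m_comm)
  ultimately have "\<gamma> \<in> adjoin R K \<theta>"
    using subfield_m_inv_simprule[OF N _ \<gamma>c, of "i \<oplus> \<one>"] subN(7)[OF iN subN(3)] by blast
  then have "M \<subseteq> adjoin R K \<theta>" using adjoin2_least[OF N KN(1) iN] ME by auto
  then have "adjoin R K \<theta> = M" using adjoin_least[OF Msf KM(1) \<theta>M] by blast
  moreover have "\<theta> [^] (4::nat) \<in> K"
  proof -
    have "\<theta> [^] (4::nat) = c \<otimes> c \<otimes> (i \<otimes> i)"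
      unfolding nat_pow_four[OF \<theta>c] \<theta>2 using cc ic by algebra
    then show ?thesis using sub(6) cK iiK by simp
  qed
  ultimately show ?thesis
    unfolding radical_extension_def radical_generator_def field_extension_def
    using K Msf KM(1) \<theta>M M(2) by blast
qed

subsection \<open>Square roots from the Galois group\<close>

lemma additive_minus:
  assumes L: "subfield L R" and s: "s \<in> L \<rightarrow> L" "\<forall>x\<in>L. \<forall>y\<in>L. s (x \<oplus> y) = s x \<oplus> s y"
    and x: "x \<in> L"
  shows "s (\<ominus> x) = \<ominus> s x"
proof -
  note sub = subringE[OF subfieldE(1)[OF L]]
  have car: "\<And>x. x \<in> L \<Longrightarrow> x \<in> carrier R" "\<And>x. x \<in> L \<Longrightarrow> s x \<in> carrier R"
    using sub(1) s(1) by auto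
  have "s \<zero> \<oplus> s \<zero> = s \<zero>" using s(2) sub(2) by (metis l_zero zero_closed)
  then have z: "s \<zero> = \<zero>" using car(2)[OF sub(2)] by (metis add.l_cancel_one')
  have "s (\<ominus> x) \<oplus> s x = \<zero>"
    using bspec[OF bspec[OF s(2) sub(5)[OF x]] x] z car(1)[OF x] by (simp add: l_neg)
  then show ?thesis using car(2)[OF x] car(2)[OF sub(5)[OF x]] minus_equality by metis
qed

text \<open>The difference y = x - s x is nonzero and is negated by s. By commutation t y is negated
  too, so y + t y has both required properties unless it vanishes, and in that case t y = -
  y.\<close>

lemma common_eigenvector:
  assumes L: "subfield L R"
    and s: "s \<in> L \<rightarrow> L" "\<forall>x\<in>L. \<forall>y\<in>L. s (x \<oplus> y) = s x \<oplus> s y"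
      "\<forall>x\<in>L. s (s x) = x"
    and t: "t \<in> L \<rightarrow> L" "\<forall>x\<in>L. \<forall>y\<in>L. t (x \<oplus> y) = t x \<oplus> t y"
      "\<forall>x\<in>L. t (t x) = x"
    and comm: "\<forall>x\<in>L. s (t x) = t (s x)"
    and x: "x \<in> L" "s x \<noteq> x"
  obtains u where "u \<in> L" "u \<noteq> \<zero>" "s u = \<ominus> u" "t u = u \<or> t u = \<ominus> u"
proof -
  note sub = subringE[OF subfieldE(1)[OF L]]
  note sm = additive_minus[OF L s(1,2)] and tm = additive_minus[OF L t(1,2)]
  define y where "y = x \<oplus> \<ominus> s x"
  have sx: "s x \<in> L" using s(1) x(1) by auto
  then have y: "y \<in> L" unfolding y_def using sub(5,7) x(1) by simp
  have xc: "x \<in> carrier R" "s x \<in> carrier R" "y \<in> carrier R" using sub(1) x(1) sx y by auto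
  have y0: "y \<noteq> \<zero>" unfolding y_def using x(2) xc by (metis minus_equality minus_minus a_inv_closed)
  have sy: "s y = \<ominus> y"
  proof -
    have "s y = s x \<oplus> \<ominus> x" unfolding y_def using s(2,3) sm sx sub(5) x(1) by simp
    also have "\<dots> = \<ominus> y" unfolding y_def using xc by algebra
    finally show ?thesis .
  qed
  have ty: "t y \<in> L" using t(1) y by auto
  then have tc: "t y \<in> carrier R" using sub(1) by auto
  have sty: "s (t y) = \<ominus> t y" using comm y sy tm[OF y] by simp
  show thesis
  proof (cases "y \<oplus> t y = \<zero>")
    case True
    then have "t y = \<ominus> y" using xc(3) tc by (metis a_comm minus_equality)
    then show ?thesis using that y y0 sy by blast
  next
    case False
    have "s (y \<oplus> t y) = \<ominus> (y \<oplus> t y)"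
      using bspec[OF bspec[OF s(2) y] ty] sy sty xc(3) tc by (simp add: minus_add)
    moreover have "t (y \<oplus> t y) = y \<oplus> t y"
      using bspec[OF bspec[OF t(2) y] ty] bspec[OF t(3) y] xc(3) tc by (simp add: a_comm)
    ultimately show ?thesis using that False sub(7)[OF y ty] by blast
  qed
qed

text \<open>Unpacks the abstract isomorphism: g and h are the preimages of (1, 0) and (0, 1). As the
  group consists of the identity, g, h and their composite, an element fixed by g and h is fixed by
  all of it and lies in F.\<close>

lemma elementary_abelian_involutions:
  assumes "elementary_abelian_quartic R F L"
  obtains g h where
    "\<And>\<sigma>. \<sigma> \<in> {g, h} \<Longrightarrow> \<sigma> \<in> L \<rightarrow> L \<and>
       (\<forall>x\<in>L. \<forall>y\<in>L. \<sigma> (x \<oplus> y) = \<sigma> x \<oplus> \<sigma> y \<and> \<sigma> (x \<otimes> y) = \<sigma> x \<otimes> \<sigma> y) \<and>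
       (\<forall>x\<in>F. \<sigma> x = x) \<and> (\<forall>x\<in>L. \<sigma> (\<sigma> x) = x)"
    "\<forall>x\<in>L. g (h x) = h (g x)"
    "\<And>x. x \<in> L \<Longrightarrow> g x = x \<Longrightarrow> h x = x \<Longrightarrow> x \<in> F"
    "\<exists>x\<in>L. g x \<noteq> x" "\<exists>x\<in>L. h x \<noteq> x" "\<exists>x\<in>L. g (h x) \<noteq> x"
proof -
  define C where "C = carrier (galois_group R F L)"
  have L: "subfield L R" and FL: "F \<subseteq> L"
    and fixed: "{x \<in> L. \<forall>\<sigma>\<in>C. \<sigma> x = x} = F"
    using assms unfolding elementary_abelian_quartic_def galois_extension_def field_extension_def C_def
    by auto
  note sub = subringE[OF subfieldE(1)[OF L]]
  have C_iff: "\<sigma> \<in> C \<longleftrightarrow> \<sigma> \<in> Bij L \<and>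
    \<sigma> \<in> ring_iso (R\<lparr>carrier := L\<rparr>) (R\<lparr>carrier := L\<rparr>) \<and> (\<forall>x\<in>F. \<sigma> x = x)" for \<sigma>
    unfolding C_def galois_group_def by simp
  have C: "\<sigma> \<in> C \<longleftrightarrow> \<sigma> \<in> Bij L \<and>
    (\<forall>x\<in>L. \<forall>y\<in>L. \<sigma> (x \<oplus> y) = \<sigma> x \<oplus> \<sigma> y \<and> \<sigma> (x \<otimes> y) = \<sigma> x \<otimes> \<sigma> y) \<and>
    \<sigma> \<one> = \<one> \<and> (\<forall>x\<in>F. \<sigma> x = x)" for \<sigma>
    unfolding C_iff ring_iso_def ring_hom_def Bij_def bij_betw_def by auto
  have Bij: "\<sigma> \<in> Bij L" if "\<sigma> \<in> C" for \<sigma> using that C by blast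
  have maps: "\<sigma> \<in> L \<rightarrow> L" if "\<sigma> \<in> C" for \<sigma> using Bij[OF that] Bij_imp_funcset by blast
  have comp: "compose L \<sigma> \<tau> \<in> C" if "\<sigma> \<in> C" "\<tau> \<in> C" for \<sigma> \<tau>
    using that maps[OF that(2)] FL sub(3,6,7) unfolding C
    by (auto simp: compose_Bij compose_eq Pi_iff subsetD)
  have idC: "(\<lambda>x\<in>L. x) \<in> C"
    unfolding C using id_Bij sub(3,6,7) FL by auto
  have mult: "\<sigma> \<otimes>\<^bsub>galois_group R F L\<^esub> \<tau> = compose L \<sigma> \<tau>" if "\<sigma> \<in> C" "\<tau> \<in> C" for \<sigma> \<tau>
    unfolding galois_group_def using Bij that by (simp add: BijGroup_def)
  obtain \<phi> where "\<phi> \<in> iso (galois_group R F L) (integer_mod_group 2 \<times>\<times> integer_mod_group 2)"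
    using assms unfolding elementary_abelian_quartic_def is_iso_def by blast
  moreover have "carrier (integer_mod_group 2) = {0, 1}"
    by (auto simp: carrier_integer_mod_group)
  ultimately have bij: "bij_betw \<phi> C ({0, 1} \<times> {0, 1})"
    and hom0: "\<And>\<sigma> \<tau>. \<sigma> \<in> C \<Longrightarrow> \<tau> \<in> C \<Longrightarrow>
      \<phi> (compose L \<sigma> \<tau>) = \<phi> \<sigma> \<otimes>\<^bsub>integer_mod_group 2 \<times>\<times> integer_mod_group 2\<^esub> \<phi> \<tau>"
    using mult unfolding iso_def hom_def C_def[symmetric]
    by auto
  have hom: "\<phi> (compose L \<sigma> \<tau>) = ((fst (\<phi> \<sigma>) + fst (\<phi> \<tau>)) mod 2, (snd (\<phi> \<sigma>) + snd (\<phi> \<tau>)) mod 2)"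
    if "\<sigma> \<in> C" "\<tau> \<in> C" for \<sigma> \<tau>
    using hom0[OF that] by (simp add: mult_DirProd' integer_mod_group_def)
  have inj: "\<sigma> = \<tau>" if "\<sigma> \<in> C" "\<tau> \<in> C" "\<phi> \<sigma> = \<phi> \<tau>" for \<sigma> \<tau>
    using bij that unfolding bij_betw_def inj_on_def by blast
  have range: "\<phi> \<sigma> \<in> {0, 1} \<times> {0, 1}" if "\<sigma> \<in> C" for \<sigma>
    using bij_betwE[OF bij] that by blast
  \<comment> \<open>The identity is idempotent, so its image is as well, and modulo 2 the only
    idempotent is (0, 0).\<close>
  have "compose L (\<lambda>x\<in>L. x) (\<lambda>x\<in>L. x) = (\<lambda>x\<in>L. x)" by (auto simp: compose_def)
  then have id0: "\<phi> (\<lambda>x\<in>L. x) = (0, 0)"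
    using hom[OF idC idC] range[OF idC] by auto
  have "(1, 0) \<in> \<phi> ` C" "(0, 1) \<in> \<phi> ` C" using bij unfolding bij_betw_def by auto
  then obtain g h where g: "g \<in> C" "\<phi> g = (1, 0)" and h: "h \<in> C" "\<phi> h = (0, 1)" by force
  have gg: "compose L g g = (\<lambda>x\<in>L. x)" and hh: "compose L h h = (\<lambda>x\<in>L. x)"
    and gh: "compose L g h = compose L h g"
    using g h hom comp idC id0 by (auto intro!: inj)
  have gh1: "\<phi> (compose L g h) = (1, 1)" using g h hom by simp
  have all: "\<sigma> \<in> {\<lambda>x\<in>L. x, g, h, compose L g h}" if "\<sigma> \<in> C" for \<sigma>
    using range[OF that] inj[OF that] g h id0 gh1 idC comp by auto
  have moves: "\<exists>x\<in>L. \<sigma> x \<noteq> x" if "\<sigma> \<in> C" "\<phi> \<sigma> \<noteq> (0, 0)" for \<sigma>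
  proof (rule ccontr)
    assume "\<not> ?thesis"
    then have "\<sigma> = (\<lambda>x\<in>L. x)"
      using Bij_imp_extensional[OF Bij[OF that(1)]] by (intro extensionalityI[of _ L]) auto
    then show False using id0 that by simp
  qed
  show thesis
  proof (rule that[of g h])
    show "\<sigma> \<in> L \<rightarrow> L \<and>
       (\<forall>x\<in>L. \<forall>y\<in>L. \<sigma> (x \<oplus> y) = \<sigma> x \<oplus> \<sigma> y \<and> \<sigma> (x \<otimes> y) = \<sigma> x \<otimes> \<sigma> y) \<and>
       (\<forall>x\<in>F. \<sigma> x = x) \<and> (\<forall>x\<in>L. \<sigma> (\<sigma> x) = x)" if "\<sigma> \<in> {g, h}" for \<sigma>
    proof -
      have \<sigma>: "\<sigma> \<in> C" "compose L \<sigma> \<sigma> = (\<lambda>x\<in>L. x)" using that g h gg hh by auto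
      have "\<sigma> (\<sigma> x) = x" if "x \<in> L" for x
        using fun_cong[OF \<sigma>(2), of x] that by (simp add: compose_eq)
      then show ?thesis using maps[OF \<sigma>(1)] \<sigma>(1) C by blast
    qed
    show "\<forall>x\<in>L. g (h x) = h (g x)"
      using fun_cong[OF gh] by (metis compose_eq)
    show "x \<in> F" if "x \<in> L" "g x = x" "h x = x" for x
    proof -
      have "\<sigma> x = x" if "\<sigma> \<in> C" for \<sigma>
        using all[OF that] \<open>x \<in> L\<close> \<open>g x = x\<close> \<open>h x = x\<close> by (auto simp: compose_eq)
      then show ?thesis using fixed \<open>x \<in> L\<close> by blast
    qed
    show "\<exists>x\<in>L. g x \<noteq> x" "\<exists>x\<in>L. h x \<noteq> x" using moves g h by auto
    show "\<exists>x\<in>L. g (h x) \<noteq> x" using moves[OF comp[OF g(1) h(1)]] gh1 by (auto simp: compose_eq)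
  qed
qed

text \<open>If g and h act on u by signs, they fix u^2, so u^2 lies in F; u itself lies outside F
  once a sign is -1. It remains to find u and v whose sign patterns are nontrivial and distinct,
  since the pattern of u v is their product.\<close>

lemma elementary_abelian_square_roots:
  assumes two: "\<one> \<oplus> \<one> \<noteq> \<zero>" and el: "elementary_abelian_quartic R F L"
  obtains a b where "a \<in> L" "b \<in> L" "a \<otimes> a \<in> F" "b \<otimes> b \<in> F" "a \<notin> F" "b \<notin> F" "a \<otimes> b \<notin> F"
proof -
  have L: "subfield L R"
    using el unfolding elementary_abelian_quartic_def galois_extension_def field_extension_def
    by auto
  note sub = subringE[OF subfieldE(1)[OF L]]
  have car: "\<And>x. x \<in> L \<Longrightarrow> x \<in> carrier R" using sub(1) by auto
  obtain g h where
    gh: "\<And>\<sigma>. \<sigma> \<in> {g, h} \<Longrightarrow> \<sigma> \<in> L \<rightarrow> L \<and>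
       (\<forall>x\<in>L. \<forall>y\<in>L. \<sigma> (x \<oplus> y) = \<sigma> x \<oplus> \<sigma> y \<and> \<sigma> (x \<otimes> y) = \<sigma> x \<otimes> \<sigma> y) \<and>
       (\<forall>x\<in>F. \<sigma> x = x) \<and> (\<forall>x\<in>L. \<sigma> (\<sigma> x) = x)"
    and comm: "\<forall>x\<in>L. g (h x) = h (g x)"
    and fixed: "\<And>x. x \<in> L \<Longrightarrow> g x = x \<Longrightarrow> h x = x \<Longrightarrow> x \<in> F"
    and moves: "\<exists>x\<in>L. g x \<noteq> x" "\<exists>x\<in>L. h x \<noteq> x" "\<exists>x\<in>L. g (h x) \<noteq> x"
    by (rule elementary_abelian_involutions[OF el]) blast+
  have g: "g \<in> L \<rightarrow> L" "\<forall>x\<in>L. \<forall>y\<in>L. g (x \<oplus> y) = g x \<oplus> g y"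
    "\<forall>x\<in>L. g (g x) = x" "\<And>x y. x \<in> L \<Longrightarrow> y \<in> L \<Longrightarrow> g (x \<otimes> y) = g x \<otimes> g y"
    "\<And>x. x \<in> F \<Longrightarrow> g x = x"
    using gh[of g] by auto
  have h: "h \<in> L \<rightarrow> L" "\<forall>x\<in>L. \<forall>y\<in>L. h (x \<oplus> y) = h x \<oplus> h y"
    "\<forall>x\<in>L. h (h x) = x" "\<And>x y. x \<in> L \<Longrightarrow> y \<in> L \<Longrightarrow> h (x \<otimes> y) = h x \<otimes> h y"
    "\<And>x. x \<in> F \<Longrightarrow> h x = x"
    using gh[of h] by auto
  have gL: "\<And>x. x \<in> L \<Longrightarrow> g x \<in> L" and hL: "\<And>x. x \<in> L \<Longrightarrow> h x \<in> L" using g(1) h(1) by auto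
  have neg: "\<ominus> x \<noteq> x" if "x \<in> carrier R" "x \<noteq> \<zero>" for x
  proof
    assume "\<ominus> x = x"
    then have "x \<oplus> x = \<zero>" using that(1) r_neg by metis
    moreover have "x \<oplus> x = (\<one> \<oplus> \<one>) \<otimes> x" using that(1) by (simp add: l_distr)
    ultimately show False using two that integral by (metis add.m_closed one_closed)
  qed
  have square: "u \<otimes> u \<in> F" if "u \<in> L" "g u = u \<or> g u = \<ominus> u" "h u = u \<or> h u = \<ominus> u" for u
    using that fixed[OF sub(6)[OF that(1,1)]] g(4)[OF that(1,1)] h(4)[OF that(1,1)] car[OF that(1)]
    by (auto simp: l_minus r_minus)
  have outside: "u \<notin> F" if "u \<in> L" "u \<noteq> \<zero>" "g u = \<ominus> u \<or> h u = \<ominus> u" for u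
    using that neg[OF car[OF that(1)]] g(5) h(5) by metis
  obtain x where "x \<in> L" "g x \<noteq> x" using moves(1) by blast
  then obtain u where u: "u \<in> L" "u \<noteq> \<zero>" "g u = \<ominus> u" "h u = u \<or> h u = \<ominus> u"
    using common_eigenvector[OF L g(1-3) h(1-3) comm] by metis
  \<comment> \<open>If u has signs (-, +), any v negated by h will do. If u has signs (-, -), then v
    is taken negated by the composite of g and h, so that its two signs differ and each of v and u v
    is negated by g or by h.\<close>
  have "\<exists>v\<in>L. v \<noteq> \<zero> \<and> (g v = v \<or> g v = \<ominus> v) \<and> (h v = v \<or> h v = \<ominus> v) \<and>
      (g v = \<ominus> v \<or> h v = \<ominus> v) \<and> (g (u \<otimes> v) = \<ominus> (u \<otimes> v) \<or> h (u \<otimes> v) = \<ominus> (u \<otimes> v))"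
  proof (cases "h u = u")
    case True
    obtain y where "y \<in> L" "h y \<noteq> y" using moves(2) by blast
    then obtain v where v: "v \<in> L" "v \<noteq> \<zero>" "h v = \<ominus> v" "g v = v \<or> g v = \<ominus> v"
      using common_eigenvector[OF L h(1-3) g(1-3)] comm by metis
    moreover have "h (u \<otimes> v) = \<ominus> (u \<otimes> v)"
      using h(4)[OF u(1) v(1)] True v(3) car u(1) v(1) by (simp add: r_minus)
    ultimately show ?thesis by blast
  next
    case False
    obtain y where y: "y \<in> L" "g (h y) \<noteq> y" using moves(3) by blast
    have gh': "(\<lambda>x. g (h x)) \<in> L \<rightarrow> L" "\<forall>x\<in>L. \<forall>y\<in>L. g (h (x \<oplus> y)) = g (h x) \<oplus> g (h y)"
      "\<forall>x\<in>L. g (h (g (h x))) = x" "\<forall>x\<in>L. g (h (g x)) = g (g (h x))"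
      using gL hL g(2,3) h(2,3) comm by auto
    obtain v where v: "v \<in> L" "v \<noteq> \<zero>" "g (h v) = \<ominus> v" "g v = v \<or> g v = \<ominus> v"
      using common_eigenvector[OF L gh'(1-3) g(1-3) gh'(4) y] by metis
    have vc: "v \<in> carrier R" using car v(1) by blast
    have hgv: "h v = \<ominus> g v"
      using v(3) bspec[OF g(3) hL[OF v(1)]] additive_minus[OF L g(1,2) v(1)] by simp
    have mult: "g (u \<otimes> v) = \<ominus> u \<otimes> g v" "h (u \<otimes> v) = \<ominus> u \<otimes> h v"
      using g(4)[OF u(1) v(1)] h(4)[OF u(1) v(1)] u(3,4) False by auto
    show ?thesis
      using v(4)
    proof
      assume "g v = v"
      then show ?thesis using v hgv mult vc car[OF u(1)] by (intro bexI[of _ v]) (auto simp: l_minus)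
    next
      assume "g v = \<ominus> v"
      then show ?thesis using v hgv mult vc car[OF u(1)] by (intro bexI[of _ v]) (auto simp: l_minus)
    qed
  qed
  then obtain v where v: "v \<in> L" "v \<noteq> \<zero>" "g v = v \<or> g v = \<ominus> v" "h v = v \<or> h v = \<ominus> v"
    "g v = \<ominus> v \<or> h v = \<ominus> v" "g (u \<otimes> v) = \<ominus> (u \<otimes> v) \<or> h (u \<otimes> v) = \<ominus> (u \<otimes> v)" by blast
  have "u \<otimes> v \<noteq> \<zero>" using u(1,2) v(1,2) car integral by blast
  then show thesis
    using that[of u v] u v square outside sub(6) by blast
qed

subsection \<open>Radical closures\<close>

lemma two_nonzero:
  assumes "ring_char (R\<lparr>carrier := F\<rparr>) \<noteq> 2"
  shows "\<one> \<oplus> \<one> \<noteq> \<zero>"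
proof
  assume *: "\<one> \<oplus> \<one> = \<zero>"
  define P where "P n \<longleftrightarrow>
    n > 0 \<and> [n] \<cdot>\<^bsub>R\<lparr>carrier := F\<rparr>\<^esub> \<one>\<^bsub>R\<lparr>carrier := F\<rparr>\<^esub> = \<zero>\<^bsub>R\<lparr>carrier := F\<rparr>\<^esub>" for n :: nat
  have add_pow: "[n] \<cdot>\<^bsub>R\<lparr>carrier := F\<rparr>\<^esub> \<one>\<^bsub>R\<lparr>carrier := F\<rparr>\<^esub> = [n] \<cdot> \<one>" for n :: nat
    by (simp add: add_pow_def nat_pow_def)
  have P2: "P 2" unfolding P_def add_pow using * by (simp add: numeral_2_eq_2)
  moreover have "2 \<le> n" if "P n" for n
  proof (rule ccontr)
    assume "\<not> 2 \<le> n"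
    then have "n = 1" using that unfolding P_def by simp
    then show False using that unfolding P_def add_pow by simp
  qed
  ultimately have "(LEAST n. P n) = 2" by (rule Least_equality)
  then show False using assms P2 unfolding ring_char_def P_def[symmetric] by metis
qed

lemma ext_degree_eq:
  assumes "subfield K R" "dimension n K M"
  shows "ext_degree R K M = enat n"
  using dimI[OF assms] finite_dimensionI[OF assms(2)] by (simp add: ext_degree_def over_def)

lemma ext_degree_le_enatE:
  assumes K: "subfield K R" and "ext_degree R K M \<le> enat m"
  obtains n where "dimension n K M" "n \<le> m"
proof -
  have "finite_dimension K M"
    using assms(2) unfolding ext_degree_def by (auto split: if_splits)
  then obtain n where "dimension n K M" unfolding finite_dimension_def by blast
  then show thesis using that assms(2) ext_degree_eq[OF K] by simp
qed

text \<open>M may be infinite over K. Arguing by contradiction makes its degree finite, so that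
  dimensions can be compared.\<close>

lemma ext_degree_ge:
  assumes K: "subfield K R" and "dimension n K E" "E \<subseteq> M"
  shows "enat n \<le> ext_degree R K M"
proof (rule ccontr)
  assume *: "\<not> ?thesis"
  then have "ext_degree R K M \<le> enat n" by simp
  then obtain m where m: "dimension m K M" using ext_degree_le_enatE[OF K] by blast
  then show False using * dimension_mono[OF K assms(2) m assms(3)] ext_degree_eq[OF K m] by simp
qed

end

text \<open>Keeps of the Galois hypothesis only two independent square roots generating L; from here
  on, automorphisms are replaced by the position of i relative to K and K(a, b).\<close>

locale biquadratic_extension = field +
  fixes F L a b i
  assumes two: "\<one> \<oplus> \<one> \<noteq> \<zero>"
    and F: "subfield F R"
    and ab: "a \<in> carrier R" "b \<in> carrier R"
    and sq: "a \<otimes> a \<in> F" "b \<otimes> b \<in> F"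
    and indep: "a \<notin> F" "b \<notin> adjoin R F a"
    and L_eq: "L = adjoin R (adjoin R F a) b"
    and i: "i \<in> carrier R" "i \<otimes> i = \<ominus> \<one>"
begin

lemmas subF = subringE[OF subfieldE(1)[OF F]]

lemma subfield_L: "subfield L R"
  unfolding L_eq using subfield_adjoin2[OF subF(1) ab] .

lemmas subL = subringE[OF subfieldE(1)[OF subfield_L]]

lemma FL: "F \<subseteq> L" "a \<in> L" "b \<in> L"
  unfolding L_eq using subset_adjoin2[where K=F and a=a and b=b] by auto

lemma dimension_L: "dimension 4 F L"
  unfolding L_eq using dimension_four_biquadratic_iff[OF F ab sq] indep by simp

lemma i_square_mem: "subfield K R \<Longrightarrow> i \<otimes> i \<in> K"
  unfolding i(2) by (intro subringE(5) subringE(3) subfieldE(1))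

lemma i_nonzero: "i \<noteq> \<zero>"
proof
  assume "i = \<zero>"
  then have "\<ominus> \<one> = \<zero>" using i by simp
  then show False using minus_minus[OF one_closed] minus_zero one_not_zero by simp
qed

text \<open>Uniqueness of dimension turns the common degree n into 4, and the description of radical
  biquadratic extensions turns the existence of a generator into the position of i.\<close>

lemma becomes_radical_over_iff:
  "becomes_radical_over R F L K \<longleftrightarrow> field_extension R F K \<and>
     dimension 4 K (adjoin R (adjoin R K a) b) \<and> i \<in> adjoin R (adjoin R K a) b \<and> i \<notin> K"
proof (cases "field_extension R F K")
  case True
  then have K: "subfield K R" "F \<subseteq> K" unfolding field_extension_def by auto
  define M where "M = adjoin R (adjoin R K a) b"
  have comp: "compositum R L K = M"
    unfolding L_eq M_def by (rule compositum_adjoin[OF F K ab])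
  have sqK: "a \<otimes> a \<in> K" "b \<otimes> b \<in> K" using sq K(2) by auto
  have dim: "(\<exists>n. dimension n F L \<and> dimension n K M) \<longleftrightarrow> dimension 4 K M"
    using dimension_L dimension_is_inj[OF F] by metis
  have "radical_extension R K M \<longleftrightarrow> i \<in> M \<and> i \<notin> K" if "dimension 4 K M"
    using radical_generator_biquadratic(1,2)[OF two K(1) ab sqK M_def that i]
      radical_biquadratic[OF two K(1) ab sqK M_def that _ _ i(2)]
    unfolding radical_extension_def by blast
  then show ?thesis
    unfolding becomes_radical_over_def comp M_def[symmetric] using True dim by blast
qed (simp add: becomes_radical_over_def)

lemma becomes_radical_over_base_iff: "becomes_radical_over R F L F \<longleftrightarrow> i \<in> L \<and> i \<notin> F"
  unfolding becomes_radical_over_iff L_eq[symmetric] field_extension_def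
  using F dimension_L by blast

text \<open>F has degree 1 over itself, so its minimality is automatic.\<close>

lemma radical_closure_base_iff: "radical_closure R F L F \<longleftrightarrow> i \<in> L \<and> i \<notin> F"
proof -
  have "ext_degree R F F \<le> ext_degree R F K'" if "becomes_radical_over R F L K'" for K'
    using that ext_degree_ge[OF F dimension_one[OF F], of K'] ext_degree_eq[OF F dimension_one[OF F]]
    unfolding becomes_radical_over_def field_extension_def by simp
  then show ?thesis
    unfolding radical_closure_def becomes_radical_over_base_iff by blast
qed

lemma quadratic_subextension_adjoin_iff:
  assumes "x \<in> carrier R" "x \<otimes> x \<in> F"
  shows "quadratic_subextension R F L (adjoin R F x) \<longleftrightarrow> x \<in> L \<and> x \<notin> F"
proof
  show "x \<in> L \<and> x \<notin> F" if "quadratic_subextension R F L (adjoin R F x)"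
  proof
    show "x \<in> L"
      using that mem_adjoin[of x F] unfolding quadratic_subextension_def field_extension_def by blast
    show "x \<notin> F"
    proof
      assume "x \<in> F"
      then have "dimension 2 F F"
        using that adjoin_mem_eq[OF F] unfolding quadratic_subextension_def by simp
      then show False using dimension_is_inj[OF F _ dimension_one[OF F]] by fastforce
    qed
  qed
  show "quadratic_subextension R F L (adjoin R F x)" if "x \<in> L \<and> x \<notin> F"
    unfolding quadratic_subextension_def field_extension_def
    using F subfield_L subfield_adjoin[OF subF(1) assms(1)] subset_adjoin[of F x]
      adjoin_least[OF subfield_L FL(1), of x] dimension_two_adjoin_sqrt[OF F assms] that by blast
qed

text \<open>The field Q is F(\<gamma>), so the existential disappears and the generators can be
  handled as square roots of elements of F.\<close>

lemma radical_generator_quadratic_iff: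
  "(\<exists>Q. quadratic_subextension R F L Q \<and> radical_generator R F Q \<gamma>) \<longleftrightarrow>
     \<gamma> \<in> L \<and> \<gamma> \<otimes> \<gamma> \<in> F \<and> \<gamma> \<notin> F"
proof
  assume "\<exists>Q. quadratic_subextension R F L Q \<and> radical_generator R F Q \<gamma>"
  then obtain Q n where Q: "quadratic_subextension R F L Q" "\<gamma> \<in> Q" "adjoin R F \<gamma> = Q"
    "dimension n F Q" "\<gamma> [^] (n::nat) \<in> F"
    unfolding radical_generator_def by blast
  then have \<gamma>c: "\<gamma> \<in> carrier R" and d2: "dimension 2 F Q"
    unfolding quadratic_subextension_def field_extension_def using subfieldE(3) by blast+
  then have sq: "\<gamma> \<otimes> \<gamma> \<in> F"
    using Q(5) dimension_is_inj[OF F Q(4) d2] nat_pow_two by simp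
  then show "\<gamma> \<in> L \<and> \<gamma> \<otimes> \<gamma> \<in> F \<and> \<gamma> \<notin> F"
    using quadratic_subextension_adjoin_iff[OF \<gamma>c] Q(1,3) by simp
next
  assume *: "\<gamma> \<in> L \<and> \<gamma> \<otimes> \<gamma> \<in> F \<and> \<gamma> \<notin> F"
  then have \<gamma>c: "\<gamma> \<in> carrier R" using subL(1) by blast
  have "radical_generator R F (adjoin R F \<gamma>) \<gamma>"
    unfolding radical_generator_def
    using mem_adjoin[of \<gamma> F] dimension_two_adjoin_sqrt[OF F \<gamma>c] * nat_pow_two[OF \<gamma>c] by auto
  then show "\<exists>Q. quadratic_subextension R F L Q \<and> radical_generator R F Q \<gamma>"
    using quadratic_subextension_adjoin_iff[OF \<gamma>c] * by blast
qed

lemma radical_generatorE: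
  assumes "radical_generator R F L \<theta>"
  obtains \<gamma> where "\<gamma> \<in> L" "quadratic_subextension R F L (adjoin R F \<gamma>)"
    "radical_generator R F (adjoin R F \<gamma>) \<gamma>" "adjoin R F \<gamma> \<noteq> adjoin R F i" "\<theta> = \<gamma> \<otimes> (i \<oplus> \<one>)"
proof -
  obtain \<gamma> where \<gamma>: "\<gamma> \<in> L" "\<gamma> \<otimes> \<gamma> \<in> F" "\<gamma> \<notin> adjoin R F i" "\<theta> = \<gamma> \<otimes> (i \<oplus> \<one>)"
    using radical_generator_biquadratic(3)[OF two F ab sq L_eq dimension_L i assms] by blast
  have "\<gamma> \<notin> F" using \<gamma>(3) subset_adjoin[of F i] by blast
  then obtain Q where Q: "quadratic_subextension R F L Q" "radical_generator R F Q \<gamma>"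
    using radical_generator_quadratic_iff \<gamma> by blast
  moreover from Q(2) have "adjoin R F \<gamma> = Q" unfolding radical_generator_def by blast
  ultimately show thesis using that \<gamma> mem_adjoin[of \<gamma> F] by blast
qed

lemma no_radical_closure: "i \<in> F \<Longrightarrow> \<not> radical_closure R F L K"
  unfolding radical_closure_def becomes_radical_over_iff field_extension_def by blast

text \<open>F already qualifies, so any closure has degree 1. This is needed for the count: the
  number of closures is then 1 and not 3.\<close>

lemma radical_closures_inside:
  assumes "i \<in> L" "i \<notin> F"
  shows "{K. radical_closure R F L K} = {F}"
proof -
  have "K = F" if "radical_closure R F L K" for K
  proof -
    have "ext_degree R F K \<le> enat 1"
      using that ext_degree_eq[OF F dimension_one[OF F]] assms becomes_radical_over_base_iff
      unfolding radical_closure_def by metis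
    then obtain n where n: "dimension n F K" "n \<le> 1" using ext_degree_le_enatE[OF F] by blast
    have "F \<subseteq> K"
      using that unfolding radical_closure_def becomes_radical_over_def field_extension_def by blast
    then show ?thesis using dimension_subset_eq[OF F dimension_one[OF F] n(1)] n(2) by simp
  qed
  then show ?thesis using radical_closure_base_iff assms by blast
qed

lemma square_roots:
  assumes "c \<in> {a, b, a \<otimes> b}"
  shows "c \<in> L" "c \<otimes> c \<in> F" "c \<notin> F"
proof -
  have "(a \<otimes> b) \<otimes> (a \<otimes> b) = (a \<otimes> a) \<otimes> (b \<otimes> b)" using ab by algebra
  then show "c \<otimes> c \<in> F" using assms sq subF(6) by auto
  show "c \<in> L" using assms FL subL(6) by blast
  show "c \<notin> F"
    using assms indep sqrt_mem_adjoin_sqrt_iff[OF two F ab sq indep(1)] by blast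
qed

section \<open>The case where i lies outside L\<close>

context
  assumes iL: "i \<notin> L"
begin

lemma imaginary_quadratic:
  assumes "\<gamma> \<in> L" "\<gamma> \<otimes> \<gamma> \<in> F" "\<gamma> \<notin> F"
  shows "\<gamma> \<otimes> i \<in> carrier R" "(\<gamma> \<otimes> i) \<otimes> (\<gamma> \<otimes> i) \<in> F" "\<gamma> \<otimes> i \<notin> L" "\<gamma> \<otimes> i \<notin> F"
proof -
  have \<gamma>: "\<gamma> \<in> carrier R" "\<gamma> \<noteq> \<zero>" using assms(1,3) subL(1) subF(2) by auto
  show "\<gamma> \<otimes> i \<in> carrier R" using \<gamma> i by simp
  have "(\<gamma> \<otimes> i) \<otimes> (\<gamma> \<otimes> i) = (\<gamma> \<otimes> \<gamma>) \<otimes> (i \<otimes> i)" using \<gamma>(1) i(1) by algebra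
  then show "(\<gamma> \<otimes> i) \<otimes> (\<gamma> \<otimes> i) \<in> F" using subF(6)[OF assms(2) i_square_mem[OF F]] by simp
  show nL: "\<gamma> \<otimes> i \<notin> L"
    using subfield_m_inv_simprule[OF subfield_L _ i(1), of \<gamma>] assms(1) \<gamma>(2) iL by blast
  show "\<gamma> \<otimes> i \<notin> F" using nL FL(1) by blast
qed

text \<open>If a, b or a b were in F(\<gamma> i), it would be an F-multiple of \<gamma> i, forcing
  \<gamma> i into L; so the degree stays 4 over F(\<gamma> i). The compositum contains \<gamma> and
  \<gamma> i, hence i.\<close>

lemma becomes_radical_over_imaginary_quadratic:
  assumes \<gamma>: "\<gamma> \<in> L" "\<gamma> \<otimes> \<gamma> \<in> F" "\<gamma> \<notin> F"
  shows "becomes_radical_over R F L (adjoin R F (\<gamma> \<otimes> i))" (is "becomes_radical_over R F L ?K")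
proof -
  note im = imaginary_quadratic[OF assms]
  have K: "subfield ?K R" using subfield_adjoin[OF subF(1) im(1)] .
  have FK: "F \<subseteq> ?K" "\<gamma> \<otimes> i \<in> ?K" using subset_adjoin mem_adjoin by auto
  have \<gamma>': "\<gamma> \<in> carrier R" "\<gamma> \<noteq> \<zero>" using assms(1,3) subL(1) subF(2) by auto
  have notin: "c \<notin> ?K" if c: "c \<in> {a, b, a \<otimes> b}" for c
  proof
    assume "c \<in> ?K"
    then obtain y where y: "y \<in> F" "y \<noteq> \<zero>" "c = y \<otimes> (\<gamma> \<otimes> i)"
      using sqrt_in_adjoin_sqrt[OF two F im(1,2,4)] square_roots(2,3)[OF c] by metis
    then have "\<gamma> \<otimes> i \<in> L"
      using subfield_m_inv_simprule[OF subfield_L _ im(1), of y] square_roots(1)[OF c] FL(1) by auto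
    then show False using im(3) by blast
  qed
  let ?M = "adjoin R (adjoin R ?K a) b"
  have sqK: "a \<otimes> a \<in> ?K" "b \<otimes> b \<in> ?K" using sq FK by auto
  have "b \<notin> adjoin R ?K a"
    using sqrt_mem_adjoin_sqrt_iff[OF two K ab sqK] notin by blast
  then have d4: "dimension 4 ?K ?M"
    using dimension_four_biquadratic_iff[OF K ab sqK] notin by blast
  have M: "subfield ?M R" using subfield_adjoin2[OF subfieldE(3)[OF K] ab] .
  have KM: "?K \<subseteq> ?M" "a \<in> ?M" "b \<in> ?M"
    using subset_adjoin2[where K="?K" and a=a and b=b] by auto
  have "L \<subseteq> ?M" unfolding L_eq using adjoin2_least[OF M _ KM(2,3), of F] FK KM(1) by blast
  then have "\<gamma> \<in> ?M - {\<zero>}" using \<gamma>(1) \<gamma>'(2) by auto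
  moreover have "\<gamma> \<otimes> i \<in> ?M" using subsetD[OF KM(1) FK(2)] .
  ultimately have iM: "i \<in> ?M" using subfield_m_inv_simprule[OF M _ i(1)] by simp
  \<comment> \<open>If i were in F(\<gamma> i), it would be y \<gamma> i with y in F; cancelling i
    makes \<gamma> the inverse of y, hence an element of F.\<close>
  have "i \<notin> ?K"
  proof
    assume iK: "i \<in> ?K"
    have iF: "i \<notin> F" using iL FL(1) by blast
    obtain y where y: "y \<in> F" "y \<noteq> \<zero>" "i = y \<otimes> (\<gamma> \<otimes> i)"
      using sqrt_in_adjoin_sqrt[OF two F im(1,2,4) iK i_square_mem[OF F] iF] .
    have yc: "y \<in> carrier R" using y(1) subF(1) by blast
    have "\<one> \<otimes> i = (y \<otimes> \<gamma>) \<otimes> i" using y(3) yc \<gamma>'(1) i(1) by (simp add: m_assoc)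
    then have "y \<otimes> \<gamma> = \<one>"
      using m_rcancel[OF i_nonzero i(1)] yc \<gamma>'(1) by (metis m_closed one_closed)
    then show False
      using subfield_m_inv_simprule[OF F _ \<gamma>'(1), of y] y(1,2) subF(3) \<gamma>(3) by simp
  qed
  then show ?thesis
    unfolding becomes_radical_over_iff field_extension_def using F K FK(1) d4 iM by blast
qed

lemma becomes_radical_over_contains:
  assumes "becomes_radical_over R F L K"
  obtains c where "c \<in> {a, b, a \<otimes> b}" "adjoin R F (c \<otimes> i) \<subseteq> K"
proof -
  have K: "subfield K R" "F \<subseteq> K" and d4: "dimension 4 K (adjoin R (adjoin R K a) b)"
    and iM: "i \<in> adjoin R (adjoin R K a) b" "i \<notin> K"
    using assms unfolding becomes_radical_over_iff field_extension_def by auto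
  have sqK: "a \<otimes> a \<in> K" "b \<otimes> b \<in> K" using sq K(2) by auto
  have nin: "a \<notin> K" "b \<notin> adjoin R K a"
    using d4 dimension_four_biquadratic_iff[OF K(1) ab sqK] by auto
  obtain c y where cy: "c \<in> {a, b, a \<otimes> b}" "y \<in> K" "i = y \<otimes> c"
    using sqrt_in_biquadratic[OF two K(1) ab sqK nin iM(1) i_square_mem[OF K(1)] iM(2)] by metis
  have "c \<in> carrier R" "y \<in> carrier R" using cy(1,2) ab subfieldE(3)[OF K(1)] by auto
  then have "c \<otimes> i = y \<otimes> (c \<otimes> c)" unfolding cy(3) by algebra
  then have "c \<otimes> i \<in> K"
    using subringE(6)[OF subfieldE(1)[OF K(1)] cy(2)] square_roots(2)[OF cy(1)] K(2) by auto
  then show thesis using that[OF cy(1)] adjoin_least[OF K] by blast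
qed

text \<open>The three candidates all have degree 2 and every competitor contains one of them, so 2
  is the minimal degree. A closure has degree at most 2 and therefore equals the candidate inside
  it.\<close>

lemma radical_closure_iff:
  "radical_closure R F L K \<longleftrightarrow> (\<exists>c\<in>{a, b, a \<otimes> b}. K = adjoin R F (c \<otimes> i))"
proof
  assume K: "radical_closure R F L K"
  then obtain c where c: "c \<in> {a, b, a \<otimes> b}" "adjoin R F (c \<otimes> i) \<subseteq> K"
    using becomes_radical_over_contains unfolding radical_closure_def by blast
  note d2 = dimension_two_adjoin_sqrt[OF F imaginary_quadratic(1,2,4)[OF square_roots[OF c(1)]]]
  have "ext_degree R F K \<le> enat 2"
    using K becomes_radical_over_imaginary_quadratic[OF square_roots[OF c(1)]] ext_degree_eq[OF F d2]
    unfolding radical_closure_def by metis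
  then obtain n where "dimension n F K" "n \<le> 2" using ext_degree_le_enatE[OF F] by blast
  then show "\<exists>c\<in>{a, b, a \<otimes> b}. K = adjoin R F (c \<otimes> i)"
    using dimension_subset_eq[OF F d2 _ c(2)] c(1) by blast
next
  assume "\<exists>c\<in>{a, b, a \<otimes> b}. K = adjoin R F (c \<otimes> i)"
  then obtain c where c: "c \<in> {a, b, a \<otimes> b}" "K = adjoin R F (c \<otimes> i)" by blast
  have d2: "dimension 2 F (adjoin R F (c \<otimes> i))" if "c \<in> {a, b, a \<otimes> b}" for c
    using dimension_two_adjoin_sqrt[OF F imaginary_quadratic(1,2,4)[OF square_roots[OF that]]] .
  have "ext_degree R F K \<le> ext_degree R F K'" if K': "becomes_radical_over R F L K'" for K'
  proof -
    obtain c' where "c' \<in> {a, b, a \<otimes> b}" "adjoin R F (c' \<otimes> i) \<subseteq> K'"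
      using becomes_radical_over_contains[OF K'] .
    then show ?thesis using ext_degree_ge[OF F d2] ext_degree_eq[OF F d2[OF c(1)]] c(2) by metis
  qed
  then show "radical_closure R F L K"
    unfolding radical_closure_def c(2)
    using becomes_radical_over_imaginary_quadratic[OF square_roots[OF c(1)]] by blast
qed

text \<open>Any admissible \<gamma> is a nonzero F-multiple of a, b or a b, and scaling by F does
  not change the field F(\<gamma> i).\<close>

lemma radical_closures_eq:
  "{K. radical_closure R F L K} =
     {adjoin R F (\<gamma> \<otimes> i) | \<gamma>. \<exists>Q. quadratic_subextension R F L Q \<and> radical_generator R F Q \<gamma>}"
proof -
  have "\<exists>c\<in>{a, b, a \<otimes> b}. adjoin R F (\<gamma> \<otimes> i) = adjoin R F (c \<otimes> i)"
    if \<gamma>: "\<gamma> \<in> L" "\<gamma> \<otimes> \<gamma> \<in> F" "\<gamma> \<notin> F" for \<gamma>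
  proof -
    obtain c y where c: "c \<in> {a, b, a \<otimes> b}" "y \<in> F" "y \<noteq> \<zero>" "\<gamma> = y \<otimes> c"
      using sqrt_in_biquadratic[OF two F ab sq indep \<gamma>[unfolded L_eq]] by blast
    have cc: "c \<in> carrier R" "y \<in> carrier R" using c(1,2) ab subF(1) by auto
    then have "\<gamma> \<otimes> i = y \<otimes> (c \<otimes> i)" unfolding c(4) using i(1) by (simp add: m_assoc)
    then show ?thesis using adjoin_scale[OF F c(2,3), of "c \<otimes> i"] cc i(1) c(1) by auto
  qed
  then show ?thesis
    unfolding radical_generator_quadratic_iff radical_closure_iff using square_roots by blast
qed

lemma card_radical_closures: "card {K. radical_closure R F L K} = 3"
proof -
  \<comment> \<open>Equal fields would make c' i an F-multiple of c i; then c' = y c and c c' = y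
    c^2 lies in F.\<close>
  have distinct: "adjoin R F (c \<otimes> i) \<noteq> adjoin R F (c' \<otimes> i)"
    if c: "c \<in> {a, b, a \<otimes> b}" "c' \<in> {a, b, a \<otimes> b}" and nin: "c \<otimes> c' \<notin> F" for c c'
  proof
    assume eq: "adjoin R F (c \<otimes> i) = adjoin R F (c' \<otimes> i)"
    note im = imaginary_quadratic[OF square_roots[OF c(1)]]
      and im' = imaginary_quadratic[OF square_roots[OF c(2)]]
    obtain y where y: "y \<in> F" "c' \<otimes> i = y \<otimes> (c \<otimes> i)"
      using sqrt_in_adjoin_sqrt[OF two F im(1,2,4) _ im'(2,4)] mem_adjoin[of "c' \<otimes> i" F] eq by metis
    have cc: "c \<in> carrier R" "c' \<in> carrier R" "y \<in> carrier R" using c y(1) ab subF(1) by auto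
    then have "c' \<otimes> i = (y \<otimes> c) \<otimes> i" using y(2) i(1) by (simp add: m_assoc)
    then have "c' = y \<otimes> c" using m_rcancel[OF i_nonzero i(1)] cc by (metis m_closed)
    then have "c \<otimes> c' = y \<otimes> (c \<otimes> c)" using cc by (simp add: m_lcomm)
    then show False using nin subF(6)[OF y(1) square_roots(2)[OF c(1)]] by simp
  qed
  have a0: "a \<noteq> \<zero>" "b \<noteq> \<zero>" using square_roots(3) subF(2) by auto
  \<comment> \<open>The product of two of the three roots is a nonzero F-multiple of the third, so
    it never lies in F.\<close>
  have "a \<otimes> (a \<otimes> b) = (a \<otimes> a) \<otimes> b" "b \<otimes> (a \<otimes> b) = (b \<otimes> b) \<otimes> a" using ab by algebra+
  then have "a \<otimes> (a \<otimes> b) \<notin> F" "b \<otimes> (a \<otimes> b) \<notin> F"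
    using subfield_m_inv_simprule[OF F _ ab(1), of "b \<otimes> b"] sq square_roots(3) a0 ab integral
      subfield_m_inv_simprule[OF F _ ab(2), of "a \<otimes> a"] by auto
  moreover have "{K. radical_closure R F L K} =
      {adjoin R F (a \<otimes> i), adjoin R F (b \<otimes> i), adjoin R F (a \<otimes> b \<otimes> i)}"
    unfolding radical_closure_iff by blast
  ultimately show ?thesis
    using distinct[of a b] distinct[of a "a \<otimes> b"] distinct[of b "a \<otimes> b"]
      square_roots(3)[of "a \<otimes> b"] by simp
qed

end

end

section \<open>From the Galois hypothesis to the final statement\<close>

lemma (in field) elementary_abelian_biquadratic:
  assumes two: "\<one> \<oplus> \<one> \<noteq> \<zero>" and el: "elementary_abelian_quartic R F L"
    and i: "i \<in> carrier R" "i \<otimes> i = \<ominus> \<one>"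
  obtains a b where "biquadratic_extension R F L a b i"
proof -
  have F: "subfield F R" and L: "subfield L R" "F \<subseteq> L" and d4: "dimension 4 F L"
    using el unfolding elementary_abelian_quartic_def galois_extension_def field_extension_def
    by auto
  obtain a b where ab: "a \<in> L" "b \<in> L" "a \<otimes> a \<in> F" "b \<otimes> b \<in> F" "a \<notin> F" "b \<notin> F" "a \<otimes> b \<notin> F"
    using elementary_abelian_square_roots[OF two el] .
  have car: "a \<in> carrier R" "b \<in> carrier R" using ab(1,2) subfieldE(3)[OF L(1)] by auto
  have nin: "b \<notin> adjoin R F a"
    using sqrt_mem_adjoin_sqrt_iff[OF two F car ab(3-5)] ab(6,7) by blast
  then have "dimension 4 F (adjoin R (adjoin R F a) b)"
    using dimension_four_biquadratic_iff[OF F car ab(3,4)] ab(5) by blast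
  then have "L = adjoin R (adjoin R F a) b"
    using dimension_subset_eq[OF F _ d4] adjoin2_least[OF L ab(1,2)] by blast
  then show thesis
    using that two F car ab nin i
    by (simp add: biquadratic_extension_def biquadratic_extension_axioms_def field_axioms)
qed

theorem theorem3p4:
  fixes A :: "('a, 'b) ring_scheme" and F L :: "'a set" and i :: 'a
  assumes closure: "algebraic_closure A F"
    and char_not_2: "ring_char (A\<lparr>carrier := F\<rparr>) \<noteq> 2"
    and i_closed: "i \<in> carrier A"
    and i_square: "i [^]\<^bsub>A\<^esub> (2::nat) = \<ominus>\<^bsub>A\<^esub> \<one>\<^bsub>A\<^esub>"
    and elem_ab: "elementary_abelian_quartic A F L"
  shows
    "(radical_closure A F L F \<longleftrightarrow> quadratic_subextension A F L (adjoin A F i)) \<and>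
     (quadratic_subextension A F L (adjoin A F i) \<longrightarrow>
        radical_extension A F L \<and>
        (\<forall>\<theta>. radical_generator A F L \<theta> \<longrightarrow>
           (\<exists>\<gamma>\<in>L. quadratic_subextension A F L (adjoin A F \<gamma>) \<and>
                  radical_generator A F (adjoin A F \<gamma>) \<gamma> \<and>
                  adjoin A F \<gamma> \<noteq> adjoin A F i \<and>
                  \<theta> = \<gamma> \<otimes>\<^bsub>A\<^esub> (i \<oplus>\<^bsub>A\<^esub> \<one>\<^bsub>A\<^esub>)))) \<and>
     ((\<nexists>K. radical_closure A F L K) \<longleftrightarrow> i \<in> F) \<and>
     (card {K. radical_closure A F L K} = 3 \<longleftrightarrow> i \<notin> L) \<and>
     (i \<notin> L \<longrightarrow>
        {K. radical_closure A F L K} =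
        {adjoin A F (\<gamma> \<otimes>\<^bsub>A\<^esub> i) | \<gamma>.
           \<exists>Q. quadratic_subextension A F L Q \<and> radical_generator A F Q \<gamma>})"
proof -
  interpret A: field A using closure by (rule algebraic_closure.axioms(1))
  obtain a b where "biquadratic_extension A F L a b i"
    using A.elementary_abelian_biquadratic[OF A.two_nonzero[OF char_not_2] elem_ab i_closed]
      i_square A.nat_pow_two[OF i_closed] by auto
  then interpret biquadratic_extension A F L a b i .
  have quad: "quadratic_subextension A F L (adjoin A F i) \<longleftrightarrow> i \<in> L \<and> i \<notin> F"
    by (rule quadratic_subextension_adjoin_iff[OF i(1) i_square_mem[OF F]])
  have "radical_extension A F L" if "i \<in> L" "i \<notin> F"
    by (rule A.radical_biquadratic[OF two F ab sq L_eq dimension_L that i(2)])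
  moreover have "\<exists>\<gamma>\<in>L. quadratic_subextension A F L (adjoin A F \<gamma>) \<and>
      radical_generator A F (adjoin A F \<gamma>) \<gamma> \<and> adjoin A F \<gamma> \<noteq> adjoin A F i \<and>
      \<theta> = \<gamma> \<otimes>\<^bsub>A\<^esub> (i \<oplus>\<^bsub>A\<^esub> \<one>\<^bsub>A\<^esub>)" if "radical_generator A F L \<theta>" for \<theta>
    using radical_generatorE[OF that] by blast
  moreover have "(\<nexists>K. radical_closure A F L K) \<longleftrightarrow> i \<in> F"
  proof (cases "i \<in> L")
    case True
    then show ?thesis using no_radical_closure radical_closure_base_iff by blast
  next
    case False
    then show ?thesis using radical_closure_iff FL(1) by blast
  qed
  \<comment> \<open>For i in F the set is empty and has cardinality 0; for i in L outside F it is
    {F}, of cardinality 1. Thus 3 occurs only for i outside L.\<close>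
  moreover have "card {K. radical_closure A F L K} = 3 \<longleftrightarrow> i \<notin> L"
    using card_radical_closures no_radical_closure radical_closures_inside
    by (cases "i \<in> L"; cases "i \<in> F") auto
  ultimately show ?thesis
    using quad radical_closure_base_iff radical_closures_eq by blast
qed

end
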